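(* In any complete ontic model that satisfies ancilla independence, unitary invariance and parameter independence, every ontic model (i.e. the ontic model for every finite-dimensional quantum system in the collection) is $\psi$-complete.
   Context: A quantum system consists of a finite-dimensional Hilbert space $\mathcal{H}$ and sets $\mathcal{P}$ (preparations), $\mathcal{M}$ (measurements), $\mathcal{T}$ (transformations), together with surjective (possibly many-to-one) maps assigning to each $P\in\mathcal{P}$ a density operator $\rho$ on $\mathcal{H}$, to each $M\in\mathcal{M}$ a self-adjoint operator $A$ on $\mathcal{H}$, and to each $T\in\mathcal{T}$ a unitary $U$; we write $P_\rho, M_A, T_U$. For an eigenvalue $a$ of $A$, $[a]_A$ is the projection onto the eigenspace; quantum probabilities are $\mathrm{Tr}(U\rho U^*[a]_A)$. An ontic model for the system: a measurable space $(\Lambda,\Sigma)$; for each $M$ a Markov kernel (response function) $p_M(\cdot|\lambda)$, a probability distribution over eigenvalues of the operator representing $M$; for each $P$ a probability measure $\mu_P$ on $\Lambda$; for each $T$ a Markov kernel $\gamma_T$ from $\Lambda$ to itself; reproducing quantum predictions: $\int p_{M_A}(a|\lambda)\,d\mu_{P_\rho}(\lambda)=\mathrm{Tr}(\rho[a]_A)$ and $\iint p_{M_A}(a|\lambda)\gamma_{T_U}(d\lambda|\tilde\lambda)\,d\mu_{P_\rho}(\tilde\lambda)=\mathrm{Tr}(U\rho U^*[a]_A)$. The model is $\psi$-complete if for every preparation $P_\rho$, every measurement $M_A$ and every eigenvalue $a$ of $A$, $\int|p_{M_A}(a|\lambda)-\mathrm{Tr}(\rho[a]_A)|\,d\mu_{P_\rho}(\lambda)=0$.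 An ontic model satisfies unitary invariance if for all preparations $P_\rho$, transformations $T_U$, measurements $M_A$ and eigenvalues $a$: whenever $\mathrm{Tr}(\rho[a]_A)=\mathrm{Tr}(U\rho U^*[a]_A)$, then $p_{M_A}(a|\lambda)=\int p_{M_A}(a|\tilde\lambda)\gamma_{T_U}(d\tilde\lambda|\lambda)$ for $\mu_{P_\rho}$-almost every $\lambda$. A complete ontic model satisfies unitary invariance if all its ontic models do. Local measurements on a system with Hilbert space $\mathcal{H}_1\otimes\mathcal{H}_2$: operators $A\otimes\mathbf{1}$, $\mathbf{1}\otimes B$, or $A\otimes B$ (outcomes pairs $(a,b)$). Parameter independence: $p_{M_{A\otimes\mathbf{1}}}(a|\lambda)=\sum_b p_{M_{A\otimes B}}(a,b|\lambda)$ and $p_{M_{\mathbf{1}\otimes B}}(b|\lambda)=\sum_a p_{M_{A\otimes B}}(a,b|\lambda)$ for all $\lambda$, whenever the local procedures $M_{A\otimes\mathbf{1}}$, $M_{\mathbf{1}\otimes B}$ are those of which $M_{A\otimes B}$ consists. A complete ontic model is a collection of ontic models, one for every finite-dimensional quantum system, such that for every pair of systems with Hilbert spaces $\mathcal{H}_1,\mathcal{H}_2$ and for the system with Hilbert space $\mathcal{H}_1\otimes\mathcal{H}_2$, for each preparation $P_2$ of the second system there is a Markov kernel $\gamma_{P_2}$ from $(\Lambda_1,\Sigma_1)$ to $(\Lambda_{12},\Sigma_{12})$ such that for every preparation $P_1$ of the first system the measure $\mu_{P_1P_2}(\Delta)=\int\gamma_{P_2}(\Delta|\lambda)\,d\mu_{P_1}(\lambda)$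 is the measure of some preparation $P_1P_2$ of the joint system, represented by $\rho_1\otimes\rho_2$ when $P_1,P_2$ are represented by $\rho_1,\rho_2$. It satisfies parameter independence if all its ontic models do. It satisfies ancilla independence if for every response function $p_{M_A}$ of the first system's model there is a response function $p_{M_{A\otimes\mathbf{1}}}$ in the joint model such that for every preparation $P_2$ of the second system, $p_{M_A}(a|\lambda)=\int p_{M_{A\otimes\mathbf{1}}}(a|\tilde\lambda)\gamma_{P_2}(d\tilde\lambda|\lambda)$ for all outcomes $a$ and all $\lambda\in\Lambda_1$. *)

theory Defs
  imports "HOL-Probability.Probability" "Jordan_Normal_Form.Matrix"
begin

definition adj :: "complex mat \<Rightarrow> complex mat" where
  "adj A = mat (dim_col A) (dim_row A) (\<lambda>(i,j). cnj (A $$ (j,i)))"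

definition tr :: "complex mat \<Rightarrow> complex" where
  "tr A = (\<Sum>i<dim_row A. A $$ (i,i))"

text \<open>Kronecker product: the matrix of A (x) B on C^(n1) (x) C^(n2) = C^(n1*n2),
  basis e_i (x) e_j identified with e_(i*n2+j).\<close>
definition kron :: "complex mat \<Rightarrow> complex mat \<Rightarrow> complex mat" where
  "kron A B = mat (dim_row A * dim_row B) (dim_col A * dim_col B)
     (\<lambda>(i,j). A $$ (i div dim_row B, j div dim_col B) * B $$ (i mod dim_row B, j mod dim_col B))"

definition self_adjoint :: "nat \<Rightarrow> complex mat \<Rightarrow> bool" where
  "self_adjoint n A \<longleftrightarrow> A \<in> carrier_mat n n \<and> adj A = A"

definition unitary :: "nat \<Rightarrow> complex mat \<Rightarrow> bool" where
  "unitary n U \<longleftrightarrow> U \<in> carrier_mat n n \<and> adj U * U = 1\<^sub>m n \<and> U * adj U = 1\<^sub>m n"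

definition cinner :: "complex vec \<Rightarrow> complex vec \<Rightarrow> complex" where
  "cinner v w = (\<Sum>i<dim_vec v. cnj (v $ i) * w $ i)"

definition density :: "nat \<Rightarrow> complex mat \<Rightarrow> bool" where
  "density n \<rho> \<longleftrightarrow> self_adjoint n \<rho> \<and>
     (\<forall>v\<in>carrier_vec n. 0 \<le> Re (cinner v (\<rho> *\<^sub>v v))) \<and> tr \<rho> = 1"

text \<open>Eigenvalues (real, as outcomes of self-adjoint operators).\<close>
definition eigvals :: "nat \<Rightarrow> complex mat \<Rightarrow> real set" where
  "eigvals n A = {a. \<exists>v\<in>carrier_vec n. v \<noteq> 0\<^sub>v n \<and> A *\<^sub>v v = complex_of_real a \<cdot>\<^sub>v v}"

definition eigproj :: "nat \<Rightarrow> complex mat \<Rightarrow> real \<Rightarrow> complex mat" where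
  "eigproj n A a = (THE P. P \<in> carrier_mat n n \<and> adj P = P \<and> P * P = P \<and>
      {v\<in>carrier_vec n. P *\<^sub>v v = v} = {v\<in>carrier_vec n. A *\<^sub>v v = complex_of_real a \<cdot>\<^sub>v v})"

text \<open>
  's: systems of the collection; 'p, 'm, 't: labels of preparation, measurement and
  transformation procedures; 'l: ontic states. System s has Hilbert space C^(sdim s).
  joint s1 s2 is the system with Hilbert space H1 (x) H2 = C^(sdim s1 * sdim s2).
  prodM s1 s2 is the set of local product measurements M_(A(x)B) of joint s1 s2
  (outcomes pairs (a,b)); locs s1 s2 m is the pair of local procedures
  (M_(A(x)1), M_(1(x)B)) of which m consists.\<close>

record ('s,'p,'m,'t,'l) com =
  sdim :: "'s \<Rightarrow> nat"
  joint :: "'s \<Rightarrow> 's \<Rightarrow> 's"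
  Prep :: "'s \<Rightarrow> 'p set"
  Meas :: "'s \<Rightarrow> 'm set"
  Trans :: "'s \<Rightarrow> 't set"
  rho :: "'s \<Rightarrow> 'p \<Rightarrow> complex mat"
  obs :: "'s \<Rightarrow> 'm \<Rightarrow> complex mat"
  uni :: "'s \<Rightarrow> 't \<Rightarrow> complex mat"
  prodM :: "'s \<Rightarrow> 's \<Rightarrow> 'm set"
  locs :: "'s \<Rightarrow> 's \<Rightarrow> 'm \<Rightarrow> 'm \<times> 'm"
  Lam :: "'s \<Rightarrow> 'l measure"
  resp :: "'s \<Rightarrow> 'm \<Rightarrow> real \<Rightarrow> 'l \<Rightarrow> real"
  presp :: "'s \<Rightarrow> 's \<Rightarrow> 'm \<Rightarrow> real \<times> real \<Rightarrow> 'l \<Rightarrow> real"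
  mu :: "'s \<Rightarrow> 'p \<Rightarrow> 'l measure"
  gam :: "'s \<Rightarrow> 't \<Rightarrow> 'l \<Rightarrow> 'l measure"
  anc :: "'s \<Rightarrow> 's \<Rightarrow> 'p \<Rightarrow> 'l \<Rightarrow> 'l measure"

definition quantum_system :: "('s,'p,'m,'t,'l) com \<Rightarrow> 's \<Rightarrow> bool" where
  "quantum_system C s \<longleftrightarrow> (let n = sdim C s in
     n \<ge> 1 \<and>
     rho C s ` Prep C s = {\<rho>. density n \<rho>} \<and>
     obs C s ` Meas C s = {A. self_adjoint n A} \<and>
     uni C s ` Trans C s = {U. unitary n U})"

definition response_fn :: "'l measure \<Rightarrow> nat \<Rightarrow> complex mat \<Rightarrow> (real \<Rightarrow> 'l \<Rightarrow> real) \<Rightarrow> bool" where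
  "response_fn L n A p \<longleftrightarrow>
     (\<forall>a. p a \<in> borel_measurable L) \<and>
     (\<forall>l\<in>space L. (\<forall>a. 0 \<le> p a l) \<and> (\<forall>a. a \<notin> eigvals n A \<longrightarrow> p a l = 0) \<and>
        (\<Sum>a\<in>eigvals n A. p a l) = 1)"

definition ontic_model :: "('s,'p,'m,'t,'l) com \<Rightarrow> 's \<Rightarrow> bool" where
  "ontic_model C s \<longleftrightarrow> (let n = sdim C s; L = Lam C s in
     (\<forall>m\<in>Meas C s. response_fn L n (obs C s m) (resp C s m)) \<and>
     (\<forall>P\<in>Prep C s. mu C s P \<in> space (prob_algebra L)) \<and>
     (\<forall>T\<in>Trans C s. gam C s T \<in> L \<rightarrow>\<^sub>M prob_algebra L) \<and>
     (\<forall>P\<in>Prep C s. \<forall>m\<in>Meas C s. \<forall>a\<in>eigvals n (obs C s m).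
        complex_of_real (\<integral>l. resp C s m a l \<partial>mu C s P)
          = tr (rho C s P * eigproj n (obs C s m) a)) \<and>
     (\<forall>P\<in>Prep C s. \<forall>T\<in>Trans C s. \<forall>m\<in>Meas C s. \<forall>a\<in>eigvals n (obs C s m).
        complex_of_real (\<integral>lt. (\<integral>l. resp C s m a l \<partial>gam C s T lt) \<partial>mu C s P)
          = tr (uni C s T * rho C s P * adj (uni C s T) * eigproj n (obs C s m) a)))"

definition product_measurement ::
  "('s,'p,'m,'t,'l) com \<Rightarrow> 's \<Rightarrow> 's \<Rightarrow> 'm \<Rightarrow> complex mat \<Rightarrow> complex mat \<Rightarrow> bool" where
  "product_measurement C s1 s2 m A B \<longleftrightarrow> (let n1 = sdim C s1; n2 = sdim C s2;
       J = joint C s1 s2; n = sdim C J; L = Lam C J; p = presp C s1 s2 m in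
     (\<forall>ab. p ab \<in> borel_measurable L) \<and>
     (\<forall>l\<in>space L. (\<forall>ab. 0 \<le> p ab l) \<and>
        (\<forall>ab. ab \<notin> eigvals n1 A \<times> eigvals n2 B \<longrightarrow> p ab l = 0) \<and>
        (\<Sum>ab\<in>eigvals n1 A \<times> eigvals n2 B. p ab l) = 1) \<and>
     (\<forall>P\<in>Prep C J. \<forall>a\<in>eigvals n1 A. \<forall>b\<in>eigvals n2 B.
        complex_of_real (\<integral>l. p (a,b) l \<partial>mu C J P)
          = tr (rho C J P * kron (eigproj n1 A a) (eigproj n2 B b))) \<and>
     (\<forall>P\<in>Prep C J. \<forall>T\<in>Trans C J. \<forall>a\<in>eigvals n1 A. \<forall>b\<in>eigvals n2 B.
        complex_of_real (\<integral>lt. (\<integral>l. p (a,b) l \<partial>gam C J T lt) \<partial>mu C J P)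
          = tr (uni C J T * rho C J P * adj (uni C J T) * kron (eigproj n1 A a) (eigproj n2 B b))))"

definition local_measurements :: "('s,'p,'m,'t,'l) com \<Rightarrow> 's \<Rightarrow> 's \<Rightarrow> bool" where
  "local_measurements C s1 s2 \<longleftrightarrow> (let n1 = sdim C s1; n2 = sdim C s2; J = joint C s1 s2 in
     (\<forall>m\<in>prodM C s1 s2. \<exists>A B.
        self_adjoint n1 A \<and> self_adjoint n2 B \<and>
        fst (locs C s1 s2 m) \<in> Meas C J \<and> snd (locs C s1 s2 m) \<in> Meas C J \<and>
        obs C J (fst (locs C s1 s2 m)) = kron A (1\<^sub>m n2) \<and>
        obs C J (snd (locs C s1 s2 m)) = kron (1\<^sub>m n1) B \<and>
        product_measurement C s1 s2 m A B) \<and>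
     (\<forall>m1\<in>Meas C J. \<forall>m2\<in>Meas C J. \<forall>A B.
        self_adjoint n1 A \<and> self_adjoint n2 B \<and>
        obs C J m1 = kron A (1\<^sub>m n2) \<and> obs C J m2 = kron (1\<^sub>m n1) B \<longrightarrow>
        (\<exists>m\<in>prodM C s1 s2. locs C s1 s2 m = (m1, m2))))"

definition composition :: "('s,'p,'m,'t,'l) com \<Rightarrow> 's \<Rightarrow> 's \<Rightarrow> bool" where
  "composition C s1 s2 \<longleftrightarrow> (let J = joint C s1 s2 in
     sdim C J = sdim C s1 * sdim C s2 \<and>
     (\<forall>P2\<in>Prep C s2. anc C s1 s2 P2 \<in> Lam C s1 \<rightarrow>\<^sub>M prob_algebra (Lam C J) \<and>
        (\<forall>P1\<in>Prep C s1. \<exists>P\<in>Prep C J.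
           rho C J P = kron (rho C s1 P1) (rho C s2 P2) \<and>
           (\<forall>\<Delta>\<in>sets (Lam C J).
              measure (mu C J P) \<Delta> = (\<integral>l. measure (anc C s1 s2 P2 l) \<Delta> \<partial>mu C s1 P1)))))"

definition complete_ontic_model :: "('s,'p,'m,'t,'l) com \<Rightarrow> bool" where
  "complete_ontic_model C \<longleftrightarrow>
     (\<forall>s. quantum_system C s \<and> ontic_model C s) \<and>
     (\<forall>n\<ge>1. \<exists>s. sdim C s = n) \<and>
     (\<forall>s1 s2. composition C s1 s2 \<and> local_measurements C s1 s2)"

definition psi_complete :: "('s,'p,'m,'t,'l) com \<Rightarrow> 's \<Rightarrow> bool" where
  "psi_complete C s \<longleftrightarrow> (let n = sdim C s in
     \<forall>P\<in>Prep C s. \<forall>m\<in>Meas C s. \<forall>a\<in>eigvals n (obs C s m).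
       (\<integral>l. norm (complex_of_real (resp C s m a l) - tr (rho C s P * eigproj n (obs C s m) a))
          \<partial>mu C s P) = 0)"

definition unitary_invariance :: "('s,'p,'m,'t,'l) com \<Rightarrow> bool" where
  "unitary_invariance C \<longleftrightarrow> (\<forall>s. let n = sdim C s in
     \<forall>P\<in>Prep C s. \<forall>T\<in>Trans C s. \<forall>m\<in>Meas C s. \<forall>a\<in>eigvals n (obs C s m).
       tr (rho C s P * eigproj n (obs C s m) a)
         = tr (uni C s T * rho C s P * adj (uni C s T) * eigproj n (obs C s m) a) \<longrightarrow>
       (AE l in mu C s P. resp C s m a l = (\<integral>l'. resp C s m a l' \<partial>gam C s T l)))"

definition parameter_independence :: "('s,'p,'m,'t,'l) com \<Rightarrow> bool" where
  "parameter_independence C \<longleftrightarrow> (\<forall>s1 s2. let n1 = sdim C s1; n2 = sdim C s2;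
       J = joint C s1 s2 in
     \<forall>m\<in>prodM C s1 s2. \<forall>A B.
       self_adjoint n1 A \<and> self_adjoint n2 B \<and>
       obs C J (fst (locs C s1 s2 m)) = kron A (1\<^sub>m n2) \<and>
       obs C J (snd (locs C s1 s2 m)) = kron (1\<^sub>m n1) B \<longrightarrow>
       (\<forall>l\<in>space (Lam C J).
          (\<forall>a\<in>eigvals n1 A. resp C J (fst (locs C s1 s2 m)) a l
              = (\<Sum>b\<in>eigvals n2 B. presp C s1 s2 m (a,b) l)) \<and>
          (\<forall>b\<in>eigvals n2 B. resp C J (snd (locs C s1 s2 m)) b l
              = (\<Sum>a\<in>eigvals n1 A. presp C s1 s2 m (a,b) l))))"

definition ancilla_independence :: "('s,'p,'m,'t,'l) com \<Rightarrow> bool" where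
  "ancilla_independence C \<longleftrightarrow> (\<forall>s1 s2. let n1 = sdim C s1; n2 = sdim C s2;
       J = joint C s1 s2 in
     \<forall>m\<in>Meas C s1. \<exists>m'\<in>Meas C J. obs C J m' = kron (obs C s1 m) (1\<^sub>m n2) \<and>
       (\<forall>P2\<in>Prep C s2. \<forall>a\<in>eigvals n1 (obs C s1 m). \<forall>l\<in>space (Lam C s1).
          resp C s1 m a l = (\<integral>l'. resp C J m' a l' \<partial>anc C s1 s2 P2 l)))"

end

theory Submission
  imports Defs
begin

text \<open>
  Fix a preparation with density operator \<open>\<rho>\<close>, an eigenprojection \<open>E\<close> of an observable on \<open>H\<close>, and
  \<open>q = Tr(\<rho> E)\<close>. Adjoin an ancilla \<open>C^m (x) H\<close> in the pure state \<open>sum_j c_j (delta_j (x) e_j)\<close>, where the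
  orthonormal \<open>e_j\<close> are fixed (for \<open>j\<close> in \<open>S\<close>) or annihilated by \<open>E\<close> and \<open>sum_{j in S} c_j^2 = q\<close>. Swapping
  \<open>H\<close> with its copy in the ancilla does not change the probability of \<open>E\<close>, so by ancilla independence
  and unitary invariance the deviation of the response from \<open>q\<close> may be bounded in the swapped state.
  There \<open>H\<close> is entangled with the ancilla with Schmidt coefficients \<open>c_j\<close>. Parameter independence turns
  perfect correlations into almost sure equalities of responses, and a chained Bell inequality shows
  that outcomes \<open>j\<close>, \<open>k\<close> with \<open>c_j = c_k\<close> have almost surely equal responses. If all but two of the
  \<open>c_j^2\<close> equal \<open>1/L\<close>, the mean deviation is thus at most \<open>4/L\<close>. Such \<open>e_j\<close> exist because \<open>H\<close>
  can first be enlarged by a tensor factor, again by ancilla independence.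
\<close>

text \<open>The mean deviation from \<open>q\<close> is the quantity to follow because
  \<open>\<bar>x - q\<bar>\<close> is convex: averaging over a Markov kernel can only shrink it, so
  a bound in a larger system or after a transformation comes back to the original one. Unitary
  invariance speaks only of outcomes whose quantum probability is unchanged, which is why the
  weights in \<open>S\<close> must sum to exactly \<open>q\<close>. After the swap the state of
  \<open>H\<close> has forgotten \<open>\<rho>\<close>, mixed or not; only \<open>q\<close>
  survives. The measure after the swap need not belong to any preparation, so only its statistics
  are used. Two measurements on the same side are compared through one on the other side at the
  intermediate angle; a step of angle \<open>delta\<close> then costs only
  \<open>O(delta^2)\<close>. Equality of responses alone fixes no value, but equal responses with
  total one do. Since \<open>q\<close> need not be a multiple of \<open>1/L\<close>, two remainders
  are left over, of total weight at most \<open>2/L\<close>; they count twice, as quantum weight and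
  as mean response, and this gives \<open>4/L\<close>.\<close>

unbundle no vec_syntax

subsection \<open>Matrices, Kronecker products and eigenprojections\<close>

text \<open>The basis vector \<open>e_i (x) e_j\<close> has number \<open>i*b + j\<close>, so every
  sum over a tensor product splits into a double sum by quotient and remainder.\<close>

lemma sum_div_mod:
  fixes f :: "nat \<Rightarrow> nat \<Rightarrow> 'a::comm_monoid_add"
  shows "(\<Sum>k<a*b. f (k div b) (k mod b)) = (\<Sum>i<a. \<Sum>j<b. f i j)"
proof -
  have "(\<Sum>k<a*b. f (k div b) (k mod b)) = (\<Sum>i<a. \<Sum>k\<in>{i*b..<i*b+b}. f (k div b) (k mod b))"
    by (rule sum.nat_group[symmetric])
  also have "\<dots> = (\<Sum>i<a. \<Sum>j<b. f i j)"
  proof (rule sum.cong[OF refl])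
    fix i
    show "(\<Sum>k\<in>{i*b..<i*b+b}. f (k div b) (k mod b)) = (\<Sum>j<b. f i j)"
      by (subst sum.atLeastLessThan_shift_0) (auto simp: atLeast0LessThan intro!: sum.cong)
  qed
  finally show ?thesis .
qed

lemma mult_entry:
  assumes "A \<in> carrier_mat n m" "B \<in> carrier_mat m k" "i < n" "j < k"
  shows "(A * B) $$ (i,j) = (\<Sum>l<m. A $$ (i,l) * B $$ (l,j))"
  using assms by (auto simp: scalar_prod_def atLeast0LessThan intro!: sum.cong)

lemma mult_vec_entry:
  assumes "A \<in> carrier_mat n m" "v \<in> carrier_vec m" "i < n"
  shows "(A *\<^sub>v v) $ i = (\<Sum>l<m. A $$ (i,l) * v $ l)"
  using assms by (auto simp: scalar_prod_def atLeast0LessThan intro!: sum.cong)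

declare index_mult_mat(1) [simp del] index_mult_mat_vec [simp del]

section \<open>Adjoint, trace and Kronecker product\<close>

lemma adj_carrier [simp, intro]: "A \<in> carrier_mat n m \<Longrightarrow> adj A \<in> carrier_mat m n"
  by (auto simp: adj_def)

lemma adj_entry: "A \<in> carrier_mat n m \<Longrightarrow> i < m \<Longrightarrow> j < n \<Longrightarrow> adj A $$ (i,j) = cnj (A $$ (j,i))"
  by (auto simp: adj_def)

lemma adj_mult:
  assumes "A \<in> carrier_mat n m" "B \<in> carrier_mat m k"
  shows "adj (A * B) = adj B * adj A"
proof (rule eq_matI)
  fix i j assume "i < dim_row (adj B * adj A)" "j < dim_col (adj B * adj A)"
  then have ij: "i < k" "j < n" using assms by (auto simp: adj_def)
  have "adj (A * B) $$ (i,j) = cnj (\<Sum>l<m. A $$ (j,l) * B $$ (l,i))"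
    using assms ij by (simp add: adj_def mult_entry[OF assms ij(2,1)] del: index_mult_mat(1))
  also have "\<dots> = (adj B * adj A) $$ (i,j)"
    unfolding mult_entry[OF adj_carrier[OF assms(2)] adj_carrier[OF assms(1)] ij]
    using ij by (auto simp: adj_entry[OF assms(1)] adj_entry[OF assms(2)] mult.commute intro!: sum.cong)
  finally show "adj (A * B) $$ (i,j) = (adj B * adj A) $$ (i,j)" .
qed (use assms in \<open>auto simp: adj_def\<close>)

lemma adj_one [simp]: "adj (1\<^sub>m n) = 1\<^sub>m n"
  by (rule eq_matI) (auto simp: adj_def)

lemma adj_zero [simp]: "adj (0\<^sub>m n n) = 0\<^sub>m n n"
  by (rule eq_matI) (auto simp: adj_def)

lemma adj_add:
  assumes "A \<in> carrier_mat n m" "B \<in> carrier_mat n m"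
  shows "adj (A + B) = adj A + adj B"
  by (rule eq_matI) (use assms in \<open>auto simp: adj_def\<close>)

lemma tr_mult:
  assumes "A \<in> carrier_mat n m" "B \<in> carrier_mat m n"
  shows "tr (A * B) = (\<Sum>i<n. \<Sum>l<m. A $$ (i,l) * B $$ (l,i))"
  using assms(1,2) by (simp add: tr_def mult_entry[OF assms])

lemma tr_comm:
  assumes "A \<in> carrier_mat n m" "B \<in> carrier_mat m n"
  shows "tr (A * B) = tr (B * A)"
  unfolding tr_mult[OF assms] tr_mult[OF assms(2,1)]
  by (subst sum.swap) (simp add: mult.commute)

lemma kron_carrier [simp, intro]:
  "A \<in> carrier_mat n1 m1 \<Longrightarrow> B \<in> carrier_mat n2 m2 \<Longrightarrow> kron A B \<in> carrier_mat (n1*n2) (m1*m2)"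
  by (auto simp: kron_def)

lemma kron_entry:
  assumes "A \<in> carrier_mat n1 m1" "B \<in> carrier_mat n2 m2" "i < n1*n2" "j < m1*m2"
  shows "kron A B $$ (i,j) = A $$ (i div n2, j div m2) * B $$ (i mod n2, j mod m2)"
  using assms by (auto simp: kron_def)

lemma div_mod_lt:
  fixes i :: nat assumes "i < a * b" shows "i div b < a" "i mod b < b"
  using assms less_mult_imp_div_less by (auto intro!: mod_less_divisor gr0I)

lemma block_lt:
  fixes i :: nat assumes "i < a" "k < b" shows "i * b + k < a * b"
proof -
  have "i * b + k < i * b + b" using assms by simp
  also have "\<dots> = Suc i * b" by simp
  also have "\<dots> \<le> a * b" using assms by (intro mult_le_mono1) simp
  finally show ?thesis .
qed

lemma kron_mult:
  assumes A: "A \<in> carrier_mat n1 m1" and B: "B \<in> carrier_mat n2 m2"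
    and C: "C \<in> carrier_mat m1 k1" and D: "D \<in> carrier_mat m2 k2"
  shows "kron A B * kron C D = kron (A * C) (B * D)"
proof (rule eq_matI)
  note AB = kron_carrier[OF A B] and CD = kron_carrier[OF C D]
  have AC: "A * C \<in> carrier_mat n1 k1" and BD: "B * D \<in> carrier_mat n2 k2" using assms by auto
  fix i j assume "i < dim_row (kron (A*C) (B*D))" "j < dim_col (kron (A*C) (B*D))"
  then have i: "i < n1*n2" and j: "j < k1*k2" using assms by (auto simp: kron_def)
  note i' = div_mod_lt[OF i] and j' = div_mod_lt[OF j]
  have "(kron A B * kron C D) $$ (i,j) = (\<Sum>l<m1*m2. A $$ (i div n2, l div m2) * B $$ (i mod n2, l mod m2)
      * (C $$ (l div m2, j div k2) * D $$ (l mod m2, j mod k2)))"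
    unfolding mult_entry[OF AB CD i j]
    by (rule sum.cong) (simp_all add: kron_entry[OF A B i] kron_entry[OF C D _ j])
  also have "\<dots> = (\<Sum>l<m1. \<Sum>l'<m2. A $$ (i div n2, l) * B $$ (i mod n2, l')
      * (C $$ (l, j div k2) * D $$ (l', j mod k2)))"
    by (rule sum_div_mod)
  also have "\<dots> = (\<Sum>l<m1. A $$ (i div n2, l) * C $$ (l, j div k2)) * (\<Sum>l<m2. B $$ (i mod n2, l) * D $$ (l, j mod k2))"
    by (simp add: sum_product mult_ac)
  also have "\<dots> = kron (A*C) (B*D) $$ (i,j)"
    by (simp only: kron_entry[OF AC BD i j] mult_entry[OF A C i'(1) j'(1)] mult_entry[OF B D i'(2) j'(2)])
  finally show "(kron A B * kron C D) $$ (i,j) = kron (A*C) (B*D) $$ (i,j)" .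
qed (use assms in \<open>auto simp: kron_def\<close>)

lemma kron_adj:
  assumes A: "A \<in> carrier_mat n1 m1" and B: "B \<in> carrier_mat n2 m2"
  shows "adj (kron A B) = kron (adj A) (adj B)"
  by (rule eq_matI) (use assms in \<open>auto simp: adj_def kron_def div_mod_lt\<close>)

lemma kron_one: "kron (1\<^sub>m n) (1\<^sub>m m) = 1\<^sub>m (n*m)"
proof (rule eq_matI)
  fix i j assume "i < dim_row (1\<^sub>m (n*m) :: complex mat)" "j < dim_col (1\<^sub>m (n*m) :: complex mat)"
  then have ij: "i < n*m" "j < n*m" by auto
  have "i = j \<longleftrightarrow> i div m = j div m \<and> i mod m = j mod m"
    by (metis div_mult_mod_eq)
  then show "kron (1\<^sub>m n) (1\<^sub>m m) $$ (i,j) = 1\<^sub>m (n*m) $$ (i,j)"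
    using ij by (auto simp: kron_def div_mod_lt)
qed (auto simp: kron_def)

lemma tr_kron:
  assumes A: "A \<in> carrier_mat n n" and B: "B \<in> carrier_mat m m"
  shows "tr (kron A B) = tr A * tr B"
proof -
  have "tr (kron A B) = (\<Sum>i<n*m. A $$ (i div m, i div m) * B $$ (i mod m, i mod m))"
    using A B by (auto simp: tr_def kron_def)
  also have "\<dots> = tr A * tr B"
    using A B by (simp add: sum_div_mod[of "\<lambda>i j. A $$ (i,i) * B $$ (j,j)"] tr_def sum_product)
  finally show ?thesis .
qed

text \<open>The entries of \<open>A\<close> reappear at fixed positions of the blocks, which exist
  since \<open>m \<ge> 1\<close>. This recovers the factors of a product measurement, given only by
  existence, from the operators of its local procedures.\<close>

lemma kron_one_inject:
  assumes A: "A \<in> carrier_mat n n" "A' \<in> carrier_mat n n" and m: "m \<ge> 1"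
  shows "kron A (1\<^sub>m m) = kron A' (1\<^sub>m m) \<Longrightarrow> A = A'"
    and "kron (1\<^sub>m m) A = kron (1\<^sub>m m) A' \<Longrightarrow> A = A'"
proof -
  have one: "1\<^sub>m m \<in> carrier_mat m m" by simp
  assume eq: "kron A (1\<^sub>m m) = kron A' (1\<^sub>m m)"
  show "A = A'"
  proof (rule eq_matI)
    fix i j assume "i < dim_row A'" "j < dim_col A'"
    then have ij: "i < n" "j < n" using A by auto
    have "i * m + 0 < n * m" "j * m + 0 < n * m" using ij m by (auto intro!: block_lt)
    then show "A $$ (i,j) = A' $$ (i,j)"
      using arg_cong[OF eq, of "\<lambda>X. X $$ (i*m+0, j*m+0)"] m
      by (simp add: kron_entry[OF A(1) one] kron_entry[OF A(2) one])
  qed (use A in auto)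
next
  have one: "1\<^sub>m m \<in> carrier_mat m m" by simp
  assume eq: "kron (1\<^sub>m m) A = kron (1\<^sub>m m) A'"
  show "A = A'"
  proof (rule eq_matI)
    fix i j assume "i < dim_row A'" "j < dim_col A'"
    then have ij: "i < n" "j < n" using A by auto
    have "0 * n + i < m * n" "0 * n + j < m * n" using ij m by (intro block_lt; simp)+
    then show "A $$ (i,j) = A' $$ (i,j)"
      using arg_cong[OF eq, of "\<lambda>X. X $$ (0*n+i, 0*n+j)"] m ij
      by (simp add: kron_entry[OF one A(1)] kron_entry[OF one A(2)])
  qed (use A in auto)
qed

text \<open>With \<open>x\<close> read as an \<open>n\<close> by \<open>m\<close> array,
  \<open>A (x) 1\<close> acts on each column and, in the next lemma, \<open>1 (x) A\<close> on each
  row; eigenvector equations thus split into slices.\<close>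

lemma kron_one_vec_entry:
  assumes A: "A \<in> carrier_mat n n" and x: "x \<in> carrier_vec (n*m)" and ik: "i < n" "k < m"
  shows "(kron A (1\<^sub>m m) *\<^sub>v x) $ (i*m+k) = (A *\<^sub>v vec n (\<lambda>i. x $ (i*m+k))) $ i"
proof -
  have one: "1\<^sub>m m \<in> carrier_mat m m" by simp
  note lt = block_lt[OF ik]
  have "(kron A (1\<^sub>m m) *\<^sub>v x) $ (i*m+k)
     = (\<Sum>l<n*m. A $$ (i, l div m) * (if k = l mod m then 1 else 0) * x $ (l div m * m + l mod m))"
    unfolding mult_vec_entry[OF kron_carrier[OF A one] x lt]
    by (rule sum.cong) (use ik in \<open>auto simp: kron_entry[OF A one lt] div_mod_lt\<close>)
  also have "\<dots> = (\<Sum>l<n. \<Sum>l'<m. A $$ (i, l) * (if k = l' then 1 else 0) * x $ (l * m + l'))"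
    by (rule sum_div_mod)
  also have "\<dots> = (\<Sum>l<n. A $$ (i,l) * x $ (l*m+k))"
    using ik by (intro sum.cong refl) (simp add: if_distrib[of "\<lambda>z. _ * z"] if_distrib[of "\<lambda>z. z * _"] cong: if_cong)
  also have "\<dots> = (A *\<^sub>v vec n (\<lambda>i. x $ (i*m+k))) $ i"
    using ik by (simp add: mult_vec_entry[OF A])
  finally show ?thesis .
qed

lemma one_kron_vec_entry:
  assumes A: "A \<in> carrier_mat m m" and x: "x \<in> carrier_vec (n*m)" and ik: "i < n" "k < m"
  shows "(kron (1\<^sub>m n) A *\<^sub>v x) $ (i*m+k) = (A *\<^sub>v vec m (\<lambda>k. x $ (i*m+k))) $ k"
proof -
  have one: "1\<^sub>m n \<in> carrier_mat n n" by simp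
  note lt = block_lt[OF ik]
  have "(kron (1\<^sub>m n) A *\<^sub>v x) $ (i*m+k)
     = (\<Sum>l<n*m. (if i = l div m then 1 else 0) * A $$ (k, l mod m) * x $ (l div m * m + l mod m))"
    unfolding mult_vec_entry[OF kron_carrier[OF one A] x lt]
    by (rule sum.cong) (use ik in \<open>auto simp: kron_entry[OF one A lt] div_mod_lt\<close>)
  also have "\<dots> = (\<Sum>l<n. \<Sum>l'<m. (if i = l then 1 else 0) * A $$ (k, l') * x $ (l * m + l'))"
    by (rule sum_div_mod)
  also have "\<dots> = (\<Sum>l<n. if i = l then \<Sum>l'<m. A $$ (k,l') * x $ (i*m+l') else 0)"
    by (intro sum.cong refl) auto
  also have "\<dots> = (A *\<^sub>v vec m (\<lambda>k. x $ (i*m+k))) $ k"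
    using ik by (simp add: mult_vec_entry[OF A])
  finally show ?thesis .
qed

lemma eq_vec_block:
  assumes "x \<in> carrier_vec (n*m)" "y \<in> carrier_vec (n*m)"
    and "\<And>i k. i < n \<Longrightarrow> k < m \<Longrightarrow> x $ (i*m+k) = y $ (i*m+k)"
  shows "x = y"
proof (rule eq_vecI)
  fix i assume "i < dim_vec y"
  then have "i < n*m" using assms by auto
  then show "x $ i = y $ i" using assms(3)[OF div_mod_lt[of i n m]] by simp
qed (use assms in auto)

section \<open>Eigenprojections as unique orthogonal projections\<close>

lemma zero_mult_vec: "v \<in> carrier_vec n \<Longrightarrow> 0\<^sub>m n n *\<^sub>v v = 0\<^sub>v n"
  by (rule eq_vecI) (auto simp: mult_vec_entry[of _ n n])

lemma mult_zero_vec: "A \<in> carrier_mat n n \<Longrightarrow> A *\<^sub>v 0\<^sub>v n = 0\<^sub>v n"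
  by (rule eq_vecI) (auto simp: mult_vec_entry[of _ n n])

text \<open>The condition under the \<open>THE\<close> in \<open>eigproj\<close>, as a predicate:
  existence and uniqueness have to be shown before anything can be concluded about
  \<open>eigproj\<close>.\<close>

definition is_eigproj :: "nat \<Rightarrow> complex mat \<Rightarrow> real \<Rightarrow> complex mat \<Rightarrow> bool" where
  "is_eigproj n A a P \<longleftrightarrow> P \<in> carrier_mat n n \<and> adj P = P \<and> P * P = P \<and>
      (\<forall>v\<in>carrier_vec n. P *\<^sub>v v = v \<longleftrightarrow> A *\<^sub>v v = complex_of_real a \<cdot>\<^sub>v v)"

lemma idem_vec_fixed:
  assumes "P \<in> carrier_mat n n" "P * P = P" "v \<in> carrier_vec n"
  shows "P *\<^sub>v (P *\<^sub>v v) = P *\<^sub>v v"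
  using assoc_mult_mat_vec[OF assms(1,1,3)] assms(2) by simp

text \<open>The columns of an idempotent \<open>Q\<close> are fixed by \<open>Q\<close>, hence by
  \<open>P\<close>. Besides uniqueness, the case \<open>Q = 1\<close> shows at the end that a
  projection fixing every vector is the identity.\<close>

lemma absorb_if_fixed:
  assumes P: "P \<in> carrier_mat n n" and Q: "Q \<in> carrier_mat n n" and idem: "Q * Q = Q"
    and fixd: "\<And>v. v \<in> carrier_vec n \<Longrightarrow> Q *\<^sub>v v = v \<Longrightarrow> P *\<^sub>v v = v"
  shows "P * Q = Q"
proof (rule eq_matI)
  fix i j assume "i < dim_row Q" "j < dim_col Q"
  then have ij: "i < n" "j < n" using Q by auto
  have c: "col Q j \<in> carrier_vec n" using Q by (auto intro: carrier_vecI)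
  have "col (Q * Q) j = Q *\<^sub>v col Q j" by (rule col_mult2[OF Q Q ij(2)])
  then have "Q *\<^sub>v col Q j = col Q j" by (simp add: idem)
  then have "P *\<^sub>v col Q j = col Q j" by (rule fixd[OF c])
  then have "col (P * Q) j = col Q j" by (simp only: col_mult2[OF P Q ij(2)])
  then have "col (P * Q) j $ i = col Q j $ i" by (rule arg_cong)
  then show "(P * Q) $$ (i,j) = Q $$ (i,j)"
    using P Q ij by (simp add: index_mult_mat(1) index_mult_mat_vec)
qed (use P Q in auto)

lemma is_eigproj_unique:
  assumes "is_eigproj n A a P" "is_eigproj n A a Q"
  shows "P = Q"
proof -
  have P: "P \<in> carrier_mat n n" "adj P = P" "P * P = P" and Q: "Q \<in> carrier_mat n n" "adj Q = Q" "Q * Q = Q"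
    using assms by (auto simp: is_eigproj_def)
  have fixd: "P *\<^sub>v v = v \<longleftrightarrow> Q *\<^sub>v v = v" if "v \<in> carrier_vec n" for v
    using assms that by (auto simp: is_eigproj_def)
  have "P * Q = Q" by (rule absorb_if_fixed[OF P(1) Q(1,3)]) (simp only: fixd)
  moreover have "Q * P = P" by (rule absorb_if_fixed[OF Q(1) P(1,3)]) (simp only: fixd)
  \<comment> \<open>Taking adjoints in \<open>Q * P = P\<close> gives \<open>P * Q = P\<close>,
    while \<open>P * Q = Q\<close>.\<close>
  ultimately show ?thesis using adj_mult[OF Q(1) P(1)] P(2) Q(2) by simp
qed

lemma eigproj_eqI: "is_eigproj n A a P \<Longrightarrow> eigproj n A a = P"
  unfolding eigproj_def
proof (rule the_equality)
  assume P: "is_eigproj n A a P"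
  then show "P \<in> carrier_mat n n \<and> adj P = P \<and> P * P = P \<and>
      {v\<in>carrier_vec n. P *\<^sub>v v = v} = {v\<in>carrier_vec n. A *\<^sub>v v = complex_of_real a \<cdot>\<^sub>v v}"
    by (auto simp: is_eigproj_def)
  fix Q
  assume "Q \<in> carrier_mat n n \<and> adj Q = Q \<and> Q * Q = Q \<and>
      {v\<in>carrier_vec n. Q *\<^sub>v v = v} = {v\<in>carrier_vec n. A *\<^sub>v v = complex_of_real a \<cdot>\<^sub>v v}"
  then have "is_eigproj n A a Q" unfolding is_eigproj_def by blast
  then show "Q = P" using P is_eigproj_unique by blast
qed

section \<open>Rank-one projections and unit vectors\<close>

definition outer :: "complex vec \<Rightarrow> complex mat" where
  "outer v = mat (dim_vec v) (dim_vec v) (\<lambda>(i,j). v $ i * cnj (v $ j))"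

lemma outer_carrier [simp, intro]: "v \<in> carrier_vec n \<Longrightarrow> outer v \<in> carrier_mat n n"
  by (auto simp: outer_def)

lemma adj_outer [simp]: "adj (outer v) = outer v"
  by (rule eq_matI) (auto simp: adj_def outer_def)

lemma outer_index: "i < dim_vec v \<Longrightarrow> j < dim_vec v \<Longrightarrow> outer v $$ (i,j) = v $ i * cnj (v $ j)"
  by (simp add: outer_def)

lemma cinner_sum: "v \<in> carrier_vec n \<Longrightarrow> cinner v w = (\<Sum>i<n. cnj (v $ i) * w $ i)"
  by (auto simp: cinner_def)

lemma cinner_self: "cinner v v = complex_of_real (\<Sum>i<dim_vec v. (cmod (v $ i))\<^sup>2)"
  by (simp add: cinner_def complex_norm_square mult.commute flip: of_real_power)

lemma outer_mult_vec:
  assumes "v \<in> carrier_vec n" "x \<in> carrier_vec n"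
  shows "outer v *\<^sub>v x = cinner v x \<cdot>\<^sub>v v"
proof (rule eq_vecI)
  fix i assume "i < dim_vec (cinner v x \<cdot>\<^sub>v v)"
  then have i: "i < n" using assms by auto
  show "(outer v *\<^sub>v x) $ i = (cinner v x \<cdot>\<^sub>v v) $ i"
    using assms i by (simp add: mult_vec_entry[OF outer_carrier[OF assms(1)] assms(2) i] cinner_def)
      (simp add: outer_def sum_distrib_left sum_distrib_right mult_ac)
qed (use assms in \<open>auto simp: outer_def\<close>)

lemma mult_outer:
  assumes "X \<in> carrier_mat n n" "v \<in> carrier_vec n"
  shows "X * outer v = mat n n (\<lambda>(i,j). (X *\<^sub>v v) $ i * cnj (v $ j))"
proof (rule eq_matI)
  fix i j assume "i < dim_row (mat n n (\<lambda>(i,j). (X *\<^sub>v v) $ i * cnj (v $ j)))"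
    "j < dim_col (mat n n (\<lambda>(i,j). (X *\<^sub>v v) $ i * cnj (v $ j)))"
  then have ij: "i < n" "j < n" by auto
  show "(X * outer v) $$ (i,j) = mat n n (\<lambda>(i,j). (X *\<^sub>v v) $ i * cnj (v $ j)) $$ (i,j)"
    using assms ij
    by (simp add: mult_entry[OF assms(1) outer_carrier[OF assms(2)] ij] mult_vec_entry[OF assms ij(1)])
      (simp add: outer_def sum_distrib_left sum_distrib_right mult_ac)
qed (use assms in \<open>auto simp: outer_def\<close>)

lemma outer_idem:
  assumes "v \<in> carrier_vec n" "cinner v v = 1"
  shows "outer v * outer v = outer v"
  unfolding mult_outer[OF outer_carrier[OF assms(1)] assms(1)] outer_mult_vec[OF assms(1,1)] assms(2)
  using assms(1) by (auto simp: outer_def intro!: eq_matI)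

lemma cinner_commute:
  "dim_vec v = dim_vec w \<Longrightarrow> cinner v w = cnj (cinner w v)"
  by (simp add: cinner_def mult.commute)

lemma cinner_smult_right: "dim_vec v = dim_vec w \<Longrightarrow> cinner v (c \<cdot>\<^sub>v w) = c * cinner v w"
  by (simp add: cinner_def sum_distrib_left mult_ac)

lemma tr_outer_mult:
  assumes "X \<in> carrier_mat n n" "v \<in> carrier_vec n"
  shows "tr (outer v * X) = cinner v (X *\<^sub>v v)"
proof -
  have "tr (outer v * X) = tr (X * outer v)" using assms by (intro tr_comm) auto
  then show ?thesis using assms by (simp add: mult_outer tr_def cinner_def mult.commute)
qed

lemma tr_outer: "tr (outer v) = cinner v v"
  by (simp add: tr_def outer_def cinner_def mult.commute)

lemma density_outer:
  assumes "v \<in> carrier_vec n" "cinner v v = 1"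
  shows "density n (outer v)"
proof -
  have "0 \<le> Re (cinner x (outer v *\<^sub>v x))" if "x \<in> carrier_vec n" for x
  proof -
    have "cinner x (outer v *\<^sub>v x) = cinner v x * cinner x v"
      using assms that by (simp add: outer_mult_vec cinner_smult_right)
    also have "cinner x v = cnj (cinner v x)"
      using assms that by (intro cinner_commute) auto
    finally show ?thesis by (simp add: complex_mult_cnj)
  qed
  then show ?thesis using assms by (auto simp: density_def self_adjoint_def tr_outer)
qed


lemma cinner_self_pos:
  assumes "v \<in> carrier_vec n" "v \<noteq> 0\<^sub>v n"
  obtains s where "s > 0" "cinner v v = complex_of_real (s\<^sup>2)"
proof -
  define t where "t = (\<Sum>i<dim_vec v. (cmod (v $ i))\<^sup>2)"
  have "\<exists>i<n. v $ i \<noteq> 0"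
    using assms by (metis carrier_vecD eq_vecI index_zero_vec(1,2))
  then obtain i where i: "i < n" "v $ i \<noteq> 0" by blast
  have "t > 0" unfolding t_def
    by (rule sum_pos2[of _ i]) (use i assms in auto)
  then show thesis using that[of "sqrt t"] by (simp add: cinner_self t_def)
qed

lemma normalize:
  assumes "v \<in> carrier_vec n" "v \<noteq> 0\<^sub>v n"
  obtains c where "c \<noteq> 0" "cinner (c \<cdot>\<^sub>v v) (c \<cdot>\<^sub>v v) = 1"
proof -
  obtain s where s: "s > 0" "cinner v v = complex_of_real (s\<^sup>2)"
    using cinner_self_pos[OF assms] by blast
  have "cinner (complex_of_real (1/s) \<cdot>\<^sub>v v) (complex_of_real (1/s) \<cdot>\<^sub>v v)
     = complex_of_real (1/s) * complex_of_real (1/s) * cinner v v"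
    by (simp add: cinner_def sum_distrib_left mult_ac)
  also have "\<dots> = 1" using s by (simp add: power2_eq_square)
  finally show thesis using that[of "complex_of_real (1/s)"] s by simp
qed

text \<open>Since \<open>P = adj P * P\<close>, the entry at \<open>(i,i)\<close> is the squared
  norm \<open>r\<close> of column \<open>i\<close>, and this norm contains the square of that same
  entry; so \<open>r\<^sup>2 \<le> r\<close>. Summed over \<open>i\<close>, this bounds the
  trace.\<close>

lemma projection_diag_le_one:
  assumes P: "P \<in> carrier_mat n n" "adj P = P" "P * P = P" and i: "i < n"
  shows "Re (P $$ (i,i)) \<le> 1"
proof -
  have "P $$ (i,i) = (\<Sum>l<n. P $$ (i,l) * P $$ (l,i))"
    using mult_entry[OF P(1,1) i i] P(3) by simp
  also have "\<dots> = (\<Sum>l<n. cnj (P $$ (l,i)) * P $$ (l,i))"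
    by (rule sum.cong[OF refl]) (use adj_entry[OF P(1) i] P(2) in simp)
  also have "\<dots> = complex_of_real (\<Sum>l<n. (cmod (P $$ (l,i)))\<^sup>2)"
    by (simp add: complex_norm_square mult.commute flip: of_real_power)
  finally have eq: "P $$ (i,i) = complex_of_real (\<Sum>l<n. (cmod (P $$ (l,i)))\<^sup>2)" .
  define r where "r = (\<Sum>l<n. (cmod (P $$ (l,i)))\<^sup>2)"
  have "r\<^sup>2 = (cmod (P $$ (i,i)))\<^sup>2" unfolding eq r_def by (simp only: norm_of_real power2_abs)
  also have "\<dots> \<le> r" unfolding r_def using i by (intro member_le_sum) auto
  finally have "r * r \<le> r" by (simp add: power2_eq_square)
  then have "r \<le> 1" using mult_le_cancel_left_pos[of r r 1] by (cases "r > 0") auto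
  then show ?thesis using eq by (simp add: r_def)
qed

text \<open>\<open>P * outer w = 0\<close> and its adjoint remove the cross terms. The trace, which
  stands in for the rank, grows by one.\<close>

lemma projection_extend:
  assumes P: "P \<in> carrier_mat n n" "adj P = P" "P * P = P"
    and w: "w \<in> carrier_vec n" "cinner w w = 1" "P *\<^sub>v w = 0\<^sub>v n"
  defines "Q \<equiv> P + outer w"
  shows "Q \<in> carrier_mat n n" "adj Q = Q" "Q * Q = Q" "tr Q = tr P + 1"
proof -
  have o: "outer w \<in> carrier_mat n n" using w by auto
  have Po: "P * outer w = 0\<^sub>m n n"
    using w by (auto simp: mult_outer[OF P(1) w(1)] intro!: eq_matI)
  have "adj (P * outer w) = outer w * P"
    using adj_mult[OF P(1) o] P(2) by simp
  then have oP: "outer w * P = 0\<^sub>m n n" by (simp add: Po)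
  show "Q \<in> carrier_mat n n" using P o by (auto simp: Q_def)
  show "adj Q = Q" using adj_add[OF P(1) o] P(2) by (simp add: Q_def)
  have "Q * Q = P * P + outer w * P + (P * outer w + outer w * outer w)"
    using P(1) o by (simp add: Q_def add_mult_distrib_mat[of _ n n _ _ n] mult_add_distrib_mat[of _ n n _ n])
  then show "Q * Q = Q"
    using P o by (simp add: Po oP outer_idem[OF w(1,2)] P(3) Q_def)
  have "tr Q = tr P + tr (outer w)"
    using P(1) o by (simp add: tr_def Q_def sum.distrib)
  then show "tr Q = tr P + 1" by (simp add: tr_outer w(2))
qed

text \<open>\<open>u - P u\<close> lies in the kernel by idempotence and is nonzero by assumption.
  It serves to enlarge a projection that is not maximal, and later to find a unit vector annihilated
  by \<open>E\<close>.\<close>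

lemma projection_kernel_unit:
  assumes P: "P \<in> carrier_mat n n" "P * P = P" and u: "u \<in> carrier_vec n" "P *\<^sub>v u \<noteq> u"
  obtains c where "cinner (c \<cdot>\<^sub>v (u - P *\<^sub>v u)) (c \<cdot>\<^sub>v (u - P *\<^sub>v u)) = 1"
    "P *\<^sub>v (c \<cdot>\<^sub>v (u - P *\<^sub>v u)) = 0\<^sub>v n"
proof -
  define z where "z = u - P *\<^sub>v u"
  have Pu: "P *\<^sub>v u \<in> carrier_vec n" using P u by auto
  have z: "z \<in> carrier_vec n" using u Pu by (auto simp: z_def)
  have "P *\<^sub>v z = P *\<^sub>v u - P *\<^sub>v (P *\<^sub>v u)"
    unfolding z_def by (rule mult_minus_distrib_mat_vec[OF P(1) u(1) Pu])
  then have Pz: "P *\<^sub>v z = 0\<^sub>v n" using Pu by (simp add: idem_vec_fixed[OF P u(1)])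
  have "z \<noteq> 0\<^sub>v n"
  proof
    assume z0: "z = 0\<^sub>v n"
    have "P *\<^sub>v u = u"
    proof (rule eq_vecI)
      fix i assume "i < dim_vec u"
      then have "i < n" using u by auto
      then show "(P *\<^sub>v u) $ i = u $ i" using arg_cong[OF z0, of "\<lambda>z. z $ i"] Pu u(1) P(1) by (simp add: z_def)
    qed (use Pu u P(1) in auto)
    with u(2) show False by blast
  qed
  then obtain c where "cinner (c \<cdot>\<^sub>v z) (c \<cdot>\<^sub>v z) = 1" using normalize[OF z] by blast
  moreover have "c \<cdot>\<^sub>v 0\<^sub>v n = 0\<^sub>v n" by (rule eq_vecI) auto
  ultimately show thesis using that[of c] z Pz by (simp add: z_def[symmetric] mult_mat_vec[OF P(1) z])
qed

text \<open>The eigenprojection is obtained as a projection of maximal rank among those with range inside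
  the eigenspace; this avoids the spectral theorem.\<close>
lemma is_eigproj_eigproj:
  assumes A: "A \<in> carrier_mat n n"
  shows "is_eigproj n A a (eigproj n A a)"
proof -
  define ev where "ev v \<longleftrightarrow> A *\<^sub>v v = complex_of_real a \<cdot>\<^sub>v v" for v
  have ev_diff: "ev (v - w)" if "ev v" "ev w" "v \<in> carrier_vec n" "w \<in> carrier_vec n" for v w
    using that A unfolding ev_def
    by (auto simp: mult_minus_distrib_mat_vec[of _ n n] right_diff_distrib intro!: eq_vecI)
  have ev_add: "ev (v + w)" if "ev v" "ev w" "v \<in> carrier_vec n" "w \<in> carrier_vec n" for v w
    using that A unfolding ev_def
    by (auto simp: mult_add_distrib_mat_vec[of _ n n] smult_add_distrib_vec[of _ n])
  have ev_smult: "ev (c \<cdot>\<^sub>v v)" if "ev v" "v \<in> carrier_vec n" for c v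
    using that A unfolding ev_def
    by (auto simp: mult_mat_vec[of _ n n] smult_smult_assoc mult.commute)
  \<comment> \<open>For a projection the trace is the rank; recording it as a natural number allows
    a maximum to be taken without a notion of dimension.\<close>
  define ok where "ok k P \<longleftrightarrow> P \<in> carrier_mat n n \<and> adj P = P \<and> P * P = P \<and> tr P = of_nat k
    \<and> (\<forall>v\<in>carrier_vec n. P *\<^sub>v v = v \<longrightarrow> ev v)" for k P
  have bound: "k \<le> n" if "ok k P" for k P
  proof -
    have P: "P \<in> carrier_mat n n" "adj P = P" "P * P = P" and t: "tr P = of_nat k"
      using that by (auto simp: ok_def)
    have "real k = Re (tr P)" using t by simp
    also have "\<dots> = (\<Sum>i<n. Re (P $$ (i,i)))" using P by (simp add: tr_def)
    also have "\<dots> \<le> (\<Sum>i<n. 1)" by (rule sum_mono) (use projection_diag_le_one[OF P] in auto)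
    finally show ?thesis by simp
  qed
  have "ok 0 (0\<^sub>m n n)" using A by (auto simp: ok_def tr_def ev_def zero_mult_vec mult_zero_vec)
  then have ex0: "\<exists>P. ok 0 P" by blast
  define k where "k = (GREATEST k. \<exists>P. ok k P)"
  have "\<exists>P. ok k P" unfolding k_def by (rule GreatestI_nat[of _ 0 n]) (use ex0 bound in auto)
  then obtain P where ok: "ok k P" by blast
  then have P: "P \<in> carrier_mat n n" "adj P = P" "P * P = P" and t: "tr P = of_nat k"
    and fixd: "\<And>v. v \<in> carrier_vec n \<Longrightarrow> P *\<^sub>v v = v \<Longrightarrow> ev v"
    by (auto simp: ok_def)
  have "P *\<^sub>v u = u" if u: "u \<in> carrier_vec n" "ev u" for u
  proof (rule ccontr)
    assume ne: "P *\<^sub>v u \<noteq> u"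
    define z where "z = u - P *\<^sub>v u"
    have Pu: "P *\<^sub>v u \<in> carrier_vec n" using P u by auto
    have z: "z \<in> carrier_vec n" using u Pu by (auto simp: z_def)
    have PPu: "P *\<^sub>v (P *\<^sub>v u) = P *\<^sub>v u" by (rule idem_vec_fixed[OF P(1,3) u(1)])
    \<comment> \<open>\<open>u\<close> and \<open>P u\<close> are both in the eigenspace, so the new
      direction stays inside it.\<close>
    have evz: "ev z" unfolding z_def by (rule ev_diff) (use u Pu fixd[OF Pu PPu] in auto)
    obtain c where c: "cinner (c \<cdot>\<^sub>v z) (c \<cdot>\<^sub>v z) = 1" "P *\<^sub>v (c \<cdot>\<^sub>v z) = 0\<^sub>v n"
      using projection_kernel_unit[OF P(1,3) u(1) ne] unfolding z_def by blast
    define w where "w = c \<cdot>\<^sub>v z"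
    have w: "w \<in> carrier_vec n" "cinner w w = 1" "P *\<^sub>v w = 0\<^sub>v n"
      using c z by (auto simp: w_def)
    have evw: "ev w" using ev_smult[OF evz z] by (simp add: w_def)
    note ext = projection_extend[OF P w]
    have "ev v" if v: "v \<in> carrier_vec n" "(P + outer w) *\<^sub>v v = v" for v
    proof -
      have "(P + outer w) *\<^sub>v v = P *\<^sub>v v + cinner w v \<cdot>\<^sub>v w"
        using add_mult_distrib_mat_vec[OF P(1) outer_carrier[OF w(1)] v(1)] outer_mult_vec[OF w(1) v(1)] by simp
      moreover have "P *\<^sub>v v \<in> carrier_vec n" using P v by auto
      moreover have "ev (P *\<^sub>v v)" using fixd[OF _ idem_vec_fixed[OF P(1,3) v(1)]] P v by auto
      moreover have "ev (cinner w v \<cdot>\<^sub>v w)" by (rule ev_smult[OF evw w(1)])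
      ultimately show ?thesis using ev_add w(1) v(2) by (metis smult_carrier_vec)
    qed
    \<comment> \<open>A fixed vector of the enlarged projection is a sum of two vectors of the
      eigenspace; the larger trace contradicts the choice of \<open>k\<close>.\<close>
    then have "ok (Suc k) (P + outer w)" using ext t by (auto simp: ok_def)
    then have "Suc k \<le> k" unfolding k_def using bound
      by (intro Greatest_le_nat[of _ _ n]) blast+
    then show False by simp
  qed
  then have "is_eigproj n A a P"
    using P fixd by (auto simp: is_eigproj_def ev_def)
  then show ?thesis using eigproj_eqI by metis
qed

lemma
  assumes "A \<in> carrier_mat n n"
  shows eigproj_carrier: "eigproj n A a \<in> carrier_mat n n"
    and adj_eigproj: "adj (eigproj n A a) = eigproj n A a"
    and eigproj_idem: "eigproj n A a * eigproj n A a = eigproj n A a"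
    and eigproj_fixed: "v \<in> carrier_vec n \<Longrightarrow>
      eigproj n A a *\<^sub>v v = v \<longleftrightarrow> A *\<^sub>v v = complex_of_real a \<cdot>\<^sub>v v"
  using is_eigproj_eigproj[OF assms] by (auto simp: is_eigproj_def)

lemma eigproj_projection:
  assumes "P \<in> carrier_mat n n" "adj P = P" "P * P = P"
  shows "eigproj n P 1 = P"
  by (rule eigproj_eqI) (use assms in \<open>auto simp: is_eigproj_def\<close>)

text \<open>Slicing \<open>x\<close> turns either equation into the same equation for each column,
  where the two are equivalent by the defining property of \<open>eigproj n A a\<close>.\<close>

lemma eigproj_kron_one:
  assumes A: "A \<in> carrier_mat n n"
  shows "eigproj (n*m) (kron A (1\<^sub>m m)) a = kron (eigproj n A a) (1\<^sub>m m)"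
proof (rule eigproj_eqI)
  define E where "E = eigproj n A a"
  have E: "E \<in> carrier_mat n n" "adj E = E" "E * E = E" using A by (auto simp: E_def eigproj_carrier adj_eigproj eigproj_idem)
  have one: "1\<^sub>m m \<in> carrier_mat m m" by simp
  have "kron E (1\<^sub>m m) *\<^sub>v x = x \<longleftrightarrow> kron A (1\<^sub>m m) *\<^sub>v x = complex_of_real a \<cdot>\<^sub>v x"
    if x: "x \<in> carrier_vec (n*m)" for x
  proof -
    define s where "s k = vec n (\<lambda>i. x $ (i*m+k))" for k
    have s: "s k \<in> carrier_vec n" for k by (simp add: s_def)
    have car: "kron X (1\<^sub>m m) *\<^sub>v x \<in> carrier_vec (n*m)" if "X \<in> carrier_mat n n" for X
      using kron_carrier[OF that one] x by auto
    have ent: "(kron X (1\<^sub>m m) *\<^sub>v x) $ (i*m+k) = (X *\<^sub>v s k) $ i"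
      if "X \<in> carrier_mat n n" "i < n" "k < m" for X i k
      using kron_one_vec_entry[OF that(1) x that(2,3)] by (simp add: s_def)
    have xs: "x $ (i*m+k) = s k $ i" if "i < n" "k < m" for i k using that by (simp add: s_def)
    have lt: "i*m+k < dim_vec x" if "i < n" "k < m" for i k using block_lt[OF that] x by simp
    have "kron E (1\<^sub>m m) *\<^sub>v x = x \<longleftrightarrow> (\<forall>k<m. E *\<^sub>v s k = s k)"
    proof
      assume eq: "kron E (1\<^sub>m m) *\<^sub>v x = x"
      show "\<forall>k<m. E *\<^sub>v s k = s k"
      proof (intro allI impI eq_vecI)
        fix k i assume "k < m" "i < dim_vec (s k)"
        then have ki: "i < n" "k < m" by (auto simp: s_def)
        show "(E *\<^sub>v s k) $ i = s k $ i" unfolding ent[OF E(1) ki, symmetric] eq by (rule xs[OF ki])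
      qed (use E in \<open>auto simp: s_def\<close>)
    next
      assume "\<forall>k<m. E *\<^sub>v s k = s k"
      then show "kron E (1\<^sub>m m) *\<^sub>v x = x"
        by (intro eq_vec_block[of _ n m] car[OF E(1)] x) (simp add: ent[OF E(1)] xs)
    qed
    also have "\<dots> \<longleftrightarrow> (\<forall>k<m. A *\<^sub>v s k = complex_of_real a \<cdot>\<^sub>v s k)"
      using eigproj_fixed[OF A s] by (simp add: E_def)
    also have "\<dots> \<longleftrightarrow> kron A (1\<^sub>m m) *\<^sub>v x = complex_of_real a \<cdot>\<^sub>v x"
    proof
      assume eq: "kron A (1\<^sub>m m) *\<^sub>v x = complex_of_real a \<cdot>\<^sub>v x"
      show "\<forall>k<m. A *\<^sub>v s k = complex_of_real a \<cdot>\<^sub>v s k"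
      proof (intro allI impI eq_vecI)
        fix k i assume "k < m" "i < dim_vec (complex_of_real a \<cdot>\<^sub>v s k)"
        then have ki: "i < n" "k < m" by (auto simp: s_def)
        show "(A *\<^sub>v s k) $ i = (complex_of_real a \<cdot>\<^sub>v s k) $ i"
          unfolding ent[OF A ki, symmetric] eq using xs[OF ki] lt[OF ki] s[of k] ki by simp
      qed (use A in \<open>auto simp: s_def\<close>)
    next
      assume "\<forall>k<m. A *\<^sub>v s k = complex_of_real a \<cdot>\<^sub>v s k"
      then show "kron A (1\<^sub>m m) *\<^sub>v x = complex_of_real a \<cdot>\<^sub>v x"
        using x lt s by (intro eq_vec_block[of _ n m] car[OF A]) (simp_all add: ent[OF A] xs carrier_vecD[OF s])
    qed
    finally show ?thesis .
  qed
  then show "is_eigproj (n*m) (kron A (1\<^sub>m m)) a (kron (eigproj n A a) (1\<^sub>m m))"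
    using E kron_carrier[OF E(1) one] kron_adj[OF E(1) one] kron_mult[OF E(1) one E(1) one]
    by (auto simp: is_eigproj_def E_def)
qed

text \<open>The argument of \<open>eigproj_kron_one\<close> with rows in place of columns.\<close>

lemma eigproj_one_kron:
  assumes A: "A \<in> carrier_mat m m"
  shows "eigproj (n*m) (kron (1\<^sub>m n) A) a = kron (1\<^sub>m n) (eigproj m A a)"
proof (rule eigproj_eqI)
  define E where "E = eigproj m A a"
  have E: "E \<in> carrier_mat m m" "adj E = E" "E * E = E" using A by (auto simp: E_def eigproj_carrier adj_eigproj eigproj_idem)
  have one: "1\<^sub>m n \<in> carrier_mat n n" by simp
  have "kron (1\<^sub>m n) E *\<^sub>v x = x \<longleftrightarrow> kron (1\<^sub>m n) A *\<^sub>v x = complex_of_real a \<cdot>\<^sub>v x"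
    if x: "x \<in> carrier_vec (n*m)" for x
  proof -
    define s where "s i = vec m (\<lambda>k. x $ (i*m+k))" for i
    have s: "s i \<in> carrier_vec m" for i by (simp add: s_def)
    have car: "kron (1\<^sub>m n) X *\<^sub>v x \<in> carrier_vec (n*m)" if "X \<in> carrier_mat m m" for X
      using kron_carrier[OF one that] x by auto
    have ent: "(kron (1\<^sub>m n) X *\<^sub>v x) $ (i*m+k) = (X *\<^sub>v s i) $ k"
      if "X \<in> carrier_mat m m" "i < n" "k < m" for X i k
      using one_kron_vec_entry[OF that(1) x that(2,3)] by (simp add: s_def)
    have xs: "x $ (i*m+k) = s i $ k" if "i < n" "k < m" for i k using that by (simp add: s_def)
    have lt: "i*m+k < dim_vec x" if "i < n" "k < m" for i k using block_lt[OF that] x by simp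
    have "kron (1\<^sub>m n) E *\<^sub>v x = x \<longleftrightarrow> (\<forall>i<n. E *\<^sub>v s i = s i)"
    proof
      assume eq: "kron (1\<^sub>m n) E *\<^sub>v x = x"
      show "\<forall>i<n. E *\<^sub>v s i = s i"
      proof (intro allI impI eq_vecI)
        fix i k assume "i < n" "k < dim_vec (s i)"
        then have ki: "i < n" "k < m" by (auto simp: s_def)
        show "(E *\<^sub>v s i) $ k = s i $ k" unfolding ent[OF E(1) ki, symmetric] eq by (rule xs[OF ki])
      qed (use E in \<open>auto simp: s_def\<close>)
    next
      assume "\<forall>i<n. E *\<^sub>v s i = s i"
      then show "kron (1\<^sub>m n) E *\<^sub>v x = x"
        by (intro eq_vec_block[of _ n m] car[OF E(1)] x) (simp add: ent[OF E(1)] xs)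
    qed
    also have "\<dots> \<longleftrightarrow> (\<forall>i<n. A *\<^sub>v s i = complex_of_real a \<cdot>\<^sub>v s i)"
      using eigproj_fixed[OF A s] by (simp add: E_def)
    also have "\<dots> \<longleftrightarrow> kron (1\<^sub>m n) A *\<^sub>v x = complex_of_real a \<cdot>\<^sub>v x"
    proof
      assume eq: "kron (1\<^sub>m n) A *\<^sub>v x = complex_of_real a \<cdot>\<^sub>v x"
      show "\<forall>i<n. A *\<^sub>v s i = complex_of_real a \<cdot>\<^sub>v s i"
      proof (intro allI impI eq_vecI)
        fix i k assume "i < n" "k < dim_vec (complex_of_real a \<cdot>\<^sub>v s i)"
        then have ki: "i < n" "k < m" by (auto simp: s_def)
        show "(A *\<^sub>v s i) $ k = (complex_of_real a \<cdot>\<^sub>v s i) $ k"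
          unfolding ent[OF A ki, symmetric] eq using xs[OF ki] lt[OF ki] s[of i] ki by simp
      qed (use A in \<open>auto simp: s_def\<close>)
    next
      assume "\<forall>i<n. A *\<^sub>v s i = complex_of_real a \<cdot>\<^sub>v s i"
      then show "kron (1\<^sub>m n) A *\<^sub>v x = complex_of_real a \<cdot>\<^sub>v x"
        using x lt s by (intro eq_vec_block[of _ n m] car[OF A]) (simp_all add: ent[OF A] xs carrier_vecD[OF s])
    qed
    finally show ?thesis .
  qed
  then show "is_eigproj (n*m) (kron (1\<^sub>m n) A) a (kron (1\<^sub>m n) (eigproj m A a))"
    using E kron_carrier[OF one E(1)] kron_adj[OF one E(1)] kron_mult[OF one E(1) one E(1)]
    by (auto simp: is_eigproj_def E_def)
qed

text \<open>A nonzero column of the eigenprojection is an eigenvector. Spectra of Kronecker products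
  can thus be read off their eigenprojections.\<close>

lemma eigvals_iff:
  assumes A: "A \<in> carrier_mat n n"
  shows "a \<in> eigvals n A \<longleftrightarrow> eigproj n A a \<noteq> 0\<^sub>m n n"
proof
  assume "a \<in> eigvals n A"
  then obtain v where v: "v \<in> carrier_vec n" "v \<noteq> 0\<^sub>v n" "A *\<^sub>v v = complex_of_real a \<cdot>\<^sub>v v"
    by (auto simp: eigvals_def)
  then have "eigproj n A a *\<^sub>v v = v" using eigproj_fixed[OF A] by blast
  then show "eigproj n A a \<noteq> 0\<^sub>m n n" using v by (auto simp: zero_mult_vec)
next
  define E where "E = eigproj n A a"
  have E: "E \<in> carrier_mat n n" "E * E = E" using A by (auto simp: E_def eigproj_carrier eigproj_idem)
  assume "eigproj n A a \<noteq> 0\<^sub>m n n"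
  then have "E \<noteq> 0\<^sub>m n n" by (simp add: E_def)
  then obtain i j where ij: "i < n" "j < n" "E $$ (i,j) \<noteq> 0" using E(1)
    by (metis carrier_matD eq_matI index_zero_mat)
  have c: "col E j \<in> carrier_vec n" using E by (auto intro: carrier_vecI)
  have "col E j $ i \<noteq> 0" using ij E by simp
  then have "col E j \<noteq> 0\<^sub>v n" using ij by auto
  moreover have "E *\<^sub>v col E j = col E j" using col_mult2[OF E(1,1) ij(2)] E(2) by simp
  then have "A *\<^sub>v col E j = complex_of_real a \<cdot>\<^sub>v col E j" using eigproj_fixed[OF A c] by (simp add: E_def)
  ultimately show "a \<in> eigvals n A" using c by (auto simp: eigvals_def)
qed

lemma kron_eq_0:
  assumes A: "A \<in> carrier_mat n n" and m: "m \<ge> 1"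
  shows "kron A (1\<^sub>m m) = 0\<^sub>m (n*m) (n*m) \<longleftrightarrow> A = 0\<^sub>m n n"
    and "kron (1\<^sub>m m) A = 0\<^sub>m (m*n) (m*n) \<longleftrightarrow> A = 0\<^sub>m n n"
proof -
  have z: "0\<^sub>m n n \<in> carrier_mat n n" by simp
  have 1: "kron (0\<^sub>m n n) (1\<^sub>m m) = 0\<^sub>m (n*m) (n*m)" and 2: "kron (1\<^sub>m m) (0\<^sub>m n n) = 0\<^sub>m (m*n) (m*n)"
    by (auto simp: kron_def div_mod_lt intro!: eq_matI)
  show "kron A (1\<^sub>m m) = 0\<^sub>m (n*m) (n*m) \<longleftrightarrow> A = 0\<^sub>m n n"
    using kron_one_inject(1)[OF A z m] 1 by metis
  show "kron (1\<^sub>m m) A = 0\<^sub>m (m*n) (m*n) \<longleftrightarrow> A = 0\<^sub>m n n"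
    using kron_one_inject(2)[OF A z m] 2 by metis
qed

lemma eigvals_kron_one:
  assumes A: "A \<in> carrier_mat n n" and m: "m \<ge> 1"
  shows "eigvals (n*m) (kron A (1\<^sub>m m)) = eigvals n A"
  using kron_eq_0(1)[OF eigproj_carrier[OF A] m]
  by (auto simp: eigvals_iff[OF A] eigvals_iff[OF kron_carrier[OF A one_carrier_mat]] eigproj_kron_one[OF A])

lemma eigvals_one_kron:
  assumes A: "A \<in> carrier_mat n n" and m: "m \<ge> 1"
  shows "eigvals (m*n) (kron (1\<^sub>m m) A) = eigvals n A"
  using kron_eq_0(2)[OF eigproj_carrier[OF A] m]
  by (auto simp: eigvals_iff[OF A] eigvals_iff[OF kron_carrier[OF one_carrier_mat A]] eigproj_one_kron[OF A])

section \<open>Self-adjoint operators to be measured\<close>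

lemma self_adjoint_kron:
  assumes "self_adjoint n A" "self_adjoint m B"
  shows "self_adjoint (n*m) (kron A B)"
  using assms kron_adj[of A n n B m m] by (auto simp: self_adjoint_def)

lemma self_adjoint_one: "self_adjoint n (1\<^sub>m n)"
  by (simp add: self_adjoint_def)

lemma self_adjoint_outer: "v \<in> carrier_vec n \<Longrightarrow> self_adjoint n (outer v)"
  by (auto simp: self_adjoint_def)

text \<open>An observable on \<open>C^m\<close>, the register of the labels \<open>j\<close>, with
  distinct outcomes, so that outcome \<open>real j\<close> has the rank-one projection on
  \<open>delta_j\<close>.\<close>

definition diag_nat :: "nat \<Rightarrow> complex mat" where
  "diag_nat n = mat n n (\<lambda>(i,j). if i = j then of_nat i else 0)"

lemma self_adjoint_diag_nat: "self_adjoint n (diag_nat n)"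
  by (auto simp: self_adjoint_def diag_nat_def adj_def intro!: eq_matI)

lemma eigproj_diag_nat:
  assumes "j < n"
  shows "eigproj n (diag_nat n) (real j) = outer (unit_vec n j)"
proof (rule eigproj_eqI)
  have u: "unit_vec n j \<in> carrier_vec n" by simp
  have D: "diag_nat n \<in> carrier_mat n n" by (simp add: diag_nat_def)
  have nrm: "cinner (unit_vec n j) v = v $ j" if "v \<in> carrier_vec n" for v
    using assms that by (simp add: cinner_def if_distrib[of cnj] if_distrib[of "\<lambda>z. z * _"] cong: if_cong)
  have ent: "(diag_nat n *\<^sub>v v) $ i = of_nat i * v $ i" if "v \<in> carrier_vec n" "i < n" for v i
    using that unfolding mult_vec_entry[OF D that]
    by (simp add: diag_nat_def if_distrib[of "\<lambda>z. z * _"] cong: if_cong)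
  have "outer (unit_vec n j) *\<^sub>v v = v \<longleftrightarrow> diag_nat n *\<^sub>v v = complex_of_real (real j) \<cdot>\<^sub>v v"
    if v: "v \<in> carrier_vec n" for v
  proof -
    have "outer (unit_vec n j) *\<^sub>v v = v \<longleftrightarrow> v $ j \<cdot>\<^sub>v unit_vec n j = v"
      by (simp add: outer_mult_vec[OF u v] nrm[OF v])
    also have "\<dots> \<longleftrightarrow> (\<forall>i<n. i \<noteq> j \<longrightarrow> v $ i = 0)"
      using v assms by (auto simp: Matrix.vec_eq_iff)
    also have "\<dots> \<longleftrightarrow> diag_nat n *\<^sub>v v = complex_of_real (real j) \<cdot>\<^sub>v v"
      using v D by (auto simp: Matrix.vec_eq_iff ent[OF v])
    finally show ?thesis .
  qed
  moreover have "outer (unit_vec n j) * outer (unit_vec n j) = outer (unit_vec n j)"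
    by (rule outer_idem[OF u]) (use nrm[OF u] assms in simp)
  ultimately show "is_eigproj n (diag_nat n) (real j) (outer (unit_vec n j))"
    by (auto simp: is_eigproj_def)
qed

subsection \<open>The swapped Schmidt state\<close>

text \<open>On \<open>C^d (x) (C^m (x) C^d)\<close> the basis vector with indices \<open>(a, j, b)\<close> has number
  \<open>a*(m*d) + (j*d + b)\<close>; the permutation exchanges \<open>a\<close> and \<open>b\<close>.\<close>
definition swap_ix :: "nat \<Rightarrow> nat \<Rightarrow> nat \<Rightarrow> nat" where
  "swap_ix d m i = (i mod (m*d)) mod d * (m*d) + ((i mod (m*d)) div d * d + i div (m*d))"

definition swap_mat :: "nat \<Rightarrow> nat \<Rightarrow> complex mat" where
  "swap_mat d m = mat (d*(m*d)) (d*(m*d)) (\<lambda>(i,k). if k = swap_ix d m i then 1 else 0)"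

lemma swap_ix_decode:
  assumes "i < d*(m*d)"
  shows "swap_ix d m i div (m*d) = (i mod (m*d)) mod d"
    and "(swap_ix d m i mod (m*d)) div d = (i mod (m*d)) div d"
    and "(swap_ix d m i mod (m*d)) mod d = i div (m*d)"
    and "swap_ix d m i < d*(m*d)"
proof -
  note 1 = div_mod_lt[OF assms]
  note 2 = div_mod_lt[OF 1(2)]
  have lt: "(i mod (m*d)) div d * d + i div (m*d) < m*d"
    by (rule block_lt[OF 2(1) 1(1)])
  then have "m*d \<noteq> 0" by linarith
  then show "swap_ix d m i div (m*d) = (i mod (m*d)) mod d"
    using lt by (simp add: swap_ix_def del: mult_eq_0_iff)
  have mod: "swap_ix d m i mod (m*d) = (i mod (m*d)) div d * d + i div (m*d)"
    using lt by (simp add: swap_ix_def)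
  show "(swap_ix d m i mod (m*d)) div d = (i mod (m*d)) div d"
    unfolding mod using 1 by simp
  show "(swap_ix d m i mod (m*d)) mod d = i div (m*d)"
    unfolding mod using 1 by simp
  show "swap_ix d m i < d*(m*d)"
    unfolding swap_ix_def by (rule block_lt[OF 2(2) lt])
qed

lemma swap_ix_swap_ix:
  assumes "i < d*(m*d)"
  shows "swap_ix d m (swap_ix d m i) = i"
  unfolding swap_ix_def[of d m "swap_ix d m i"]
  by (simp only: swap_ix_decode[OF assms] div_mult_mod_eq)

lemma swap_ix_eq_iff:
  assumes "i < d*(m*d)" "k < d*(m*d)"
  shows "k = swap_ix d m i \<longleftrightarrow> i = swap_ix d m k"
  using swap_ix_swap_ix assms by metis

lemma swap_mat_carrier: "swap_mat d m \<in> carrier_mat (d*(m*d)) (d*(m*d))"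
  by (simp add: swap_mat_def)

lemma adj_swap_mat: "adj (swap_mat d m) = swap_mat d m"
  by (rule eq_matI) (auto simp: adj_def swap_mat_def dest: swap_ix_eq_iff)

lemma swap_mat_mult:
  assumes Z: "Z \<in> carrier_mat (d*(m*d)) (d*(m*d))" and ik: "i < d*(m*d)" "k < d*(m*d)"
  shows "(swap_mat d m * Z) $$ (i,k) = Z $$ (swap_ix d m i, k)"
    and "(Z * swap_mat d m) $$ (i,k) = Z $$ (i, swap_ix d m k)"
proof -
  show "(swap_mat d m * Z) $$ (i,k) = Z $$ (swap_ix d m i, k)"
    unfolding mult_entry[OF swap_mat_carrier Z ik]
    using ik swap_ix_decode(4)[OF ik(1)]
    by (simp add: swap_mat_def if_distrib[of "\<lambda>z. z * _"] cong: if_cong)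
  have "(Z * swap_mat d m) $$ (i,k) = (\<Sum>l<d*(m*d). Z $$ (i,l) * (if l = swap_ix d m k then 1 else 0))"
    unfolding mult_entry[OF Z swap_mat_carrier ik]
    by (rule sum.cong) (use ik swap_ix_eq_iff[OF ik(2)] swap_ix_eq_iff[OF _ ik(2)] in \<open>auto simp: swap_mat_def\<close>)
  also have "\<dots> = Z $$ (i, swap_ix d m k)"
    using swap_ix_decode(4)[OF ik(2)] by (simp add: if_distrib[of "\<lambda>z. _ * z"] cong: if_cong)
  finally show "(Z * swap_mat d m) $$ (i,k) = Z $$ (i, swap_ix d m k)" .
qed

text \<open>Conjugation moves the operators instead of the state, so that traces in the swapped
  state can be taken against the unswapped product state.\<close>

lemma swap_mat_conj:
  assumes X: "X \<in> carrier_mat d d" and Y: "Y \<in> carrier_mat m m"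
  shows "swap_mat d m * kron X (kron Y (1\<^sub>m d)) * swap_mat d m = kron (1\<^sub>m d) (kron Y X)"
proof (rule eq_matI)
  note S = swap_mat_carrier[of d m]
  have one: "1\<^sub>m d \<in> carrier_mat d d" by simp
  note Y1 = kron_carrier[OF Y one] and YX = kron_carrier[OF Y X]
  note Z = kron_carrier[OF X Y1] and R = kron_carrier[OF one YX]
  fix i k assume "i < dim_row (kron (1\<^sub>m d) (kron Y X))" "k < dim_col (kron (1\<^sub>m d) (kron Y X))"
  then have i: "i < d*(m*d)" and k: "k < d*(m*d)" using R by auto
  note di = swap_ix_decode[OF i] and dk = swap_ix_decode[OF k]
  note i1 = div_mod_lt[OF i] and k1 = div_mod_lt[OF k]
  note i2 = div_mod_lt[OF i1(2)] and k2 = div_mod_lt[OF k1(2)]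
  have "(swap_mat d m * kron X (kron Y (1\<^sub>m d)) * swap_mat d m) $$ (i,k)
      = kron X (kron Y (1\<^sub>m d)) $$ (swap_ix d m i, swap_ix d m k)"
    using swap_mat_mult(2)[OF mult_carrier_mat[OF S Z] i k] swap_mat_mult(1)[OF Z i dk(4)] by simp
  also have "\<dots> = X $$ ((i mod (m*d)) mod d, (k mod (m*d)) mod d)
      * (Y $$ ((i mod (m*d)) div d, (k mod (m*d)) div d) * (if i div (m*d) = k div (m*d) then 1 else 0))"
    unfolding kron_entry[OF X Y1 di(4) dk(4)]
      kron_entry[OF Y one div_mod_lt(2)[OF di(4)] div_mod_lt(2)[OF dk(4)]] di(1-3) dk(1-3)
    using i1 k1 by simp
  also have "\<dots> = kron (1\<^sub>m d) (kron Y X) $$ (i,k)"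
    unfolding kron_entry[OF one YX i k] kron_entry[OF Y X i1(2) k1(2)]
    using i1 k1 by simp
  finally show "(swap_mat d m * kron X (kron Y (1\<^sub>m d)) * swap_mat d m) $$ (i,k)
      = kron (1\<^sub>m d) (kron Y X) $$ (i,k)" .
qed (use X Y swap_mat_carrier[of d m] in \<open>auto simp: kron_def\<close>)

lemma unitary_swap_mat: "unitary (d*(m*d)) (swap_mat d m)"
proof -
  have "swap_mat d m * swap_mat d m = 1\<^sub>m (d*(m*d))"
    using swap_mat_conj[of "1\<^sub>m d" d "1\<^sub>m m" m] swap_mat_carrier[of d m] by (simp add: kron_one)
  then show ?thesis by (simp add: unitary_def adj_swap_mat swap_mat_carrier)
qed

text \<open>The vector \<open>sum_j c_j (delta_j (x) e_j)\<close> in \<open>C^m (x) C^d\<close>.\<close>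
definition schmidt_vec :: "nat \<Rightarrow> nat \<Rightarrow> (nat \<Rightarrow> real) \<Rightarrow> (nat \<Rightarrow> complex vec) \<Rightarrow> complex vec" where
  "schmidt_vec d m c e = vec (m*d) (\<lambda>i. complex_of_real (c (i div d)) * e (i div d) $ (i mod d))"

lemma schmidt_vec_carrier: "schmidt_vec d m c e \<in> carrier_vec (m*d)"
  by (simp add: schmidt_vec_def)

lemma schmidt_vec_index:
  "i < m*d \<Longrightarrow> schmidt_vec d m c e $ i = complex_of_real (c (i div d)) * e (i div d) $ (i mod d)"
  by (simp add: schmidt_vec_def)

lemma cinner_schmidt_vec:
  assumes X: "X \<in> carrier_mat d d" and Y: "Y \<in> carrier_mat m m"
    and e: "\<And>j. j < m \<Longrightarrow> e j \<in> carrier_vec d"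
  shows "cinner (schmidt_vec d m c e) (kron Y X *\<^sub>v schmidt_vec d m c e)
    = (\<Sum>j<m. \<Sum>l<m. complex_of_real (c j * c l) * Y $$ (j,l) * cinner (e j) (X *\<^sub>v e l))"
proof -
  let ?p = "schmidt_vec d m c e"
  note p = schmidt_vec_carrier[of d m c e]
  have ent: "(kron Y X *\<^sub>v ?p) $ i = (\<Sum>l<m. Y $$ (i div d, l) * complex_of_real (c l) * (X *\<^sub>v e l) $ (i mod d))"
    if i: "i < m*d" for i
  proof -
    note i' = div_mod_lt[OF i]
    have "(kron Y X *\<^sub>v ?p) $ i = (\<Sum>l<m*d. Y $$ (i div d, l div d) * X $$ (i mod d, l mod d)
        * (complex_of_real (c (l div d)) * e (l div d) $ (l mod d)))"
      unfolding mult_vec_entry[OF kron_carrier[OF Y X] p i]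
      by (rule sum.cong) (simp_all add: kron_entry[OF Y X i] schmidt_vec_def)
    also have "\<dots> = (\<Sum>l<m. \<Sum>b<d. Y $$ (i div d, l) * X $$ (i mod d, b)
        * (complex_of_real (c l) * e l $ b))"
      by (rule sum_div_mod)
    also have "\<dots> = (\<Sum>l<m. Y $$ (i div d, l) * complex_of_real (c l) * (X *\<^sub>v e l) $ (i mod d))"
      by (rule sum.cong[OF refl]) (simp add: mult_vec_entry[OF X e i'(2)] sum_distrib_left mult_ac)
    finally show ?thesis .
  qed
  have "cinner ?p (kron Y X *\<^sub>v ?p) = (\<Sum>i<m*d. cnj (complex_of_real (c (i div d)) * e (i div d) $ (i mod d))
      * (\<Sum>l<m. Y $$ (i div d, l) * complex_of_real (c l) * (X *\<^sub>v e l) $ (i mod d)))"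
    unfolding cinner_sum[OF p] by (rule sum.cong) (simp_all add: ent schmidt_vec_index)
  also have "\<dots> = (\<Sum>j<m. \<Sum>b<d. cnj (complex_of_real (c j) * e j $ b)
      * (\<Sum>l<m. Y $$ (j, l) * complex_of_real (c l) * (X *\<^sub>v e l) $ b))"
    by (rule sum_div_mod)
  also have "\<dots> = (\<Sum>j<m. \<Sum>l<m. \<Sum>b<d. cnj (complex_of_real (c j) * e j $ b)
      * (Y $$ (j, l) * complex_of_real (c l) * (X *\<^sub>v e l) $ b))"
    by (rule sum.cong[OF refl]) (simp only: sum_distrib_left, rule sum.swap)
  also have "\<dots> = (\<Sum>j<m. \<Sum>l<m. complex_of_real (c j * c l) * Y $$ (j,l) * cinner (e j) (X *\<^sub>v e l))"
    by (intro sum.cong refl) (simp add: cinner_sum[OF e] sum_distrib_left mult_ac)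
  finally show ?thesis .
qed

text \<open>After the swap, the original state \<open>R\<close> sits in the last factor, where it is invisible to
  \<open>X (x) Y (x) 1\<close>, and the first two factors carry the ancilla vector \<open>p\<close>, whatever \<open>R\<close> was.\<close>
lemma tr_swapped_state:
  assumes X: "X \<in> carrier_mat d d" and Y: "Y \<in> carrier_mat m m"
    and R: "R \<in> carrier_mat d d" and p: "p \<in> carrier_vec (m*d)"
  shows "tr (swap_mat d m * kron R (outer p) * adj (swap_mat d m) * kron X (kron Y (1\<^sub>m d)))
    = tr R * cinner p (kron Y X *\<^sub>v p)"
proof -
  let ?S = "swap_mat d m" and ?N = "d*(m*d)"
  have one: "1\<^sub>m d \<in> carrier_mat d d" by simp
  note S = swap_mat_carrier[of d m]
  note Z = kron_carrier[OF X kron_carrier[OF Y one]] and YX = kron_carrier[OF Y X]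
  note K = kron_carrier[OF R outer_carrier[OF p]]
  let ?Z = "kron X (kron Y (1\<^sub>m d))" and ?K = "kron R (outer p)"
  have "?S * ?K * ?S * ?Z = ?S * (?K * (?S * ?Z))"
    using S K Z by (simp add: assoc_mult_mat[of _ ?N ?N _ ?N _ ?N])
  then have "tr (?S * ?K * adj ?S * ?Z) = tr (?S * (?K * (?S * ?Z)))" by (simp add: adj_swap_mat)
  also have "\<dots> = tr (?K * (?S * ?Z) * ?S)" using S K Z by (intro tr_comm[of _ ?N ?N]) auto
  also have "?K * (?S * ?Z) * ?S = ?K * (?S * ?Z * ?S)"
    using S K Z by (simp add: assoc_mult_mat[of _ ?N ?N _ ?N _ ?N])
  also have "\<dots> = kron (R * 1\<^sub>m d) (outer p * kron Y X)"
    unfolding swap_mat_conj[OF X Y] by (rule kron_mult[OF R outer_carrier[OF p] one YX])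
  also have "tr \<dots> = tr R * cinner p (kron Y X *\<^sub>v p)"
    using R tr_kron[OF R mult_carrier_mat[OF outer_carrier[OF p] YX]] by (simp add: tr_outer_mult[OF YX p])
  finally show ?thesis .
qed

section \<open>Correlations in a Schmidt state\<close>

definition orthonormal :: "nat \<Rightarrow> nat \<Rightarrow> (nat \<Rightarrow> complex vec) \<Rightarrow> bool" where
  "orthonormal d m e \<longleftrightarrow> (\<forall>j<m. e j \<in> carrier_vec d) \<and>
     (\<forall>j<m. \<forall>k<m. cinner (e j) (e k) = (if j = k then 1 else 0))"

text \<open>The expectation of \<open>kron Y X\<close> in \<open>schmidt_vec\<close>, with the
  arguments in the order in which the factors stand after the swap: \<open>X\<close> on
  \<open>H\<close>, then \<open>Y\<close> on the register.\<close>

definition schmidt_corr :: "nat \<Rightarrow> (nat \<Rightarrow> real) \<Rightarrow> (nat \<Rightarrow> complex vec) \<Rightarrow> complex mat \<Rightarrow> complex mat \<Rightarrow> complex" where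
  "schmidt_corr m c e X Y =
     (\<Sum>j<m. \<Sum>l<m. complex_of_real (c j * c l) * Y $$ (j,l) * cinner (e j) (X *\<^sub>v e l))"

lemma sum_delta_pair:
  fixes f :: "nat \<Rightarrow> nat \<Rightarrow> complex"
  assumes "\<And>j l. j < m \<Longrightarrow> l < m \<Longrightarrow> j \<noteq> l \<Longrightarrow> f j l = 0"
  shows "(\<Sum>j<m. \<Sum>l<m. f j l) = (\<Sum>j<m. f j j)"
proof (rule sum.cong[OF refl])
  fix j assume "j \<in> {..<m}"
  then have "(\<Sum>l<m. f j l) = (\<Sum>l<m. if l = j then f j j else 0)"
    by (intro sum.cong) (use assms in auto)
  then show "(\<Sum>l<m. f j l) = f j j" using \<open>j \<in> {..<m}\<close> by simp
qed

lemma schmidt_corr_one_left: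
  assumes "orthonormal d m e"
  shows "schmidt_corr m c e (1\<^sub>m d) Y = (\<Sum>j<m. complex_of_real ((c j)\<^sup>2) * Y $$ (j,j))"
  using assms unfolding schmidt_corr_def orthonormal_def
  by (subst sum_delta_pair) (auto simp: power2_eq_square intro!: sum.cong)

lemma schmidt_corr_one_right:
  "schmidt_corr m c e X (1\<^sub>m m) = (\<Sum>j<m. complex_of_real ((c j)\<^sup>2) * cinner (e j) (X *\<^sub>v e j))"
  unfolding schmidt_corr_def
  by (subst sum_delta_pair) (auto simp: power2_eq_square intro!: sum.cong)

lemma schmidt_corr_unit:
  assumes "k < m"
  shows "schmidt_corr m c e X (outer (unit_vec m k)) = complex_of_real ((c k)\<^sup>2) * cinner (e k) (X *\<^sub>v e k)"
proof -
  have "schmidt_corr m c e X (outer (unit_vec m k))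
    = (\<Sum>j<m. complex_of_real ((c j)\<^sup>2) * (outer (unit_vec m k) $$ (j,j)) * cinner (e j) (X *\<^sub>v e j))"
    unfolding schmidt_corr_def
    by (subst sum_delta_pair) (auto simp: power2_eq_square outer_def unit_vec_def intro!: sum.cong)
  also have "\<dots> = (\<Sum>j<m. if j = k then complex_of_real ((c k)\<^sup>2) * cinner (e k) (X *\<^sub>v e k) else 0)"
    by (rule sum.cong) (auto simp: outer_def unit_vec_def)
  finally show ?thesis using assms by simp
qed

lemma cinner_outer:
  assumes "u \<in> carrier_vec d" "v \<in> carrier_vec d" "w \<in> carrier_vec d"
  shows "cinner v (outer u *\<^sub>v w) = cinner v u * cnj (cinner w u)"
proof -
  have "cinner v (outer u *\<^sub>v w) = cinner u w * cinner v u"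
    using assms by (simp add: outer_mult_vec cinner_smult_right)
  then show ?thesis using assms cinner_commute[of u w] by simp
qed

text \<open>Both operators have rank one, so the expectation factors into an amplitude times its
  conjugate.\<close>

lemma schmidt_corr_outer:
  assumes e: "\<And>j. j < m \<Longrightarrow> e j \<in> carrier_vec d" and u: "u \<in> carrier_vec d" and w: "w \<in> carrier_vec m"
  shows "schmidt_corr m c e (outer u) (outer w)
    = (\<Sum>j<m. complex_of_real (c j) * w $ j * cinner (e j) u) * cnj (\<Sum>j<m. complex_of_real (c j) * w $ j * cinner (e j) u)"
proof -
  have "schmidt_corr m c e (outer u) (outer w)
    = (\<Sum>j<m. \<Sum>l<m. complex_of_real (c j) * w $ j * cinner (e j) u * cnj (complex_of_real (c l) * w $ l * cinner (e l) u))"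
    unfolding schmidt_corr_def
    by (intro sum.cong refl) (use w in \<open>simp add: cinner_outer[OF u e e] outer_index\<close>)
  then show ?thesis by (simp add: sum_product)
qed

text \<open>The direction at angle \<open>t\<close> in the plane of \<open>e j\<close> and
  \<open>e k\<close>. One formula serves both sides: \<open>H\<close> with \<open>e\<close>, and the
  register with \<open>unit_vec m\<close>.\<close>

definition rotated :: "(nat \<Rightarrow> complex vec) \<Rightarrow> nat \<Rightarrow> nat \<Rightarrow> real \<Rightarrow> complex vec" where
  "rotated e j k t = complex_of_real (cos t) \<cdot>\<^sub>v e j + complex_of_real (sin t) \<cdot>\<^sub>v e k"

definition rot_coeff :: "nat \<Rightarrow> nat \<Rightarrow> real \<Rightarrow> nat \<Rightarrow> real" where
  "rot_coeff j k t i = (if i = j then cos t else if i = k then sin t else 0)"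

lemma rotated_carrier:
  "orthonormal d m e \<Longrightarrow> j < m \<Longrightarrow> k < m \<Longrightarrow> rotated e j k t \<in> carrier_vec d"
  by (auto simp: orthonormal_def rotated_def)

lemma cinner_add_right:
  "dim_vec v = dim_vec w \<Longrightarrow> dim_vec v = dim_vec x \<Longrightarrow> cinner v (w + x) = cinner v w + cinner v x"
  by (simp add: cinner_def sum.distrib distrib_left)

lemma cinner_rotated:
  assumes e: "orthonormal d m e" and "j < m" "k < m" "j \<noteq> k" "i < m"
  shows "cinner (e i) (rotated e j k t) = complex_of_real (rot_coeff j k t i)"
proof -
  have d: "dim_vec (e l) = d" if "l < m" for l using e that by (auto simp: orthonormal_def)
  have "cinner (e i) (rotated e j k t) = complex_of_real (cos t) * cinner (e i) (e j)
      + complex_of_real (sin t) * cinner (e i) (e k)"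
    using assms by (simp add: rotated_def cinner_add_right cinner_smult_right d)
  then show ?thesis using assms by (auto simp: orthonormal_def rot_coeff_def)
qed

lemma cinner_zero: "v \<in> carrier_vec n \<Longrightarrow> cinner v (0\<^sub>v n) = 0"
  by (simp add: cinner_def)

lemma orthonormal_unit_vec: "orthonormal m m (unit_vec m)"
  by (auto simp: orthonormal_def cinner_def unit_vec_def if_distrib[of cnj] if_distrib[of "\<lambda>z. z * _"] cong: if_cong)

lemma rotated_unit_vec_index:
  assumes "j < m" "k < m" "j \<noteq> k" "i < m"
  shows "rotated (unit_vec m) j k t $ i = complex_of_real (rot_coeff j k t i)"
  using assms by (auto simp: rotated_def rot_coeff_def unit_vec_def)

lemma sum_rot_coeff:
  fixes f :: "nat \<Rightarrow> real"
  assumes "j < m" "k < m" "j \<noteq> k"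
  shows "(\<Sum>i<m. f i * (rot_coeff j k s i * rot_coeff j k t i)) = f j * (cos s * cos t) + f k * (sin s * sin t)"
proof -
  have "(\<Sum>i<m. f i * (rot_coeff j k s i * rot_coeff j k t i))
    = (\<Sum>i<m. (if i = j then f j * (cos s * cos t) else 0) + (if i = k then f k * (sin s * sin t) else 0))"
    by (rule sum.cong) (use assms in \<open>auto simp: rot_coeff_def\<close>)
  then show ?thesis using assms by (simp add: sum.distrib)
qed

lemma cinner_rotated_self:
  assumes e: "orthonormal d m e" and jk: "j < m" "k < m" "j \<noteq> k"
  shows "cinner (rotated e j k t) (rotated e j k t) = 1"
proof -
  have d: "dim_vec (e l) = d" if "l < m" for l using e that by (auto simp: orthonormal_def)
  have r: "rotated e j k t \<in> carrier_vec d" using rotated_carrier[OF e jk(1,2)] .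
  have "cinner (rotated e j k t) (e i) = complex_of_real (rot_coeff j k t i)" if "i < m" for i
    using cinner_commute[of "rotated e j k t" "e i"] cinner_rotated[OF e jk that] r d[OF that] by simp
  then have "cinner (rotated e j k t) (rotated e j k t)
     = complex_of_real (cos t) * complex_of_real (rot_coeff j k t j) + complex_of_real (sin t) * complex_of_real (rot_coeff j k t k)"
    \<comment> \<open>Only the right-hand occurrence is expanded, so that the coordinates just
      computed apply.\<close>
    using jk r by (subst rotated_def[of e j k t, THEN arg_cong[of _ _ "cinner (rotated e j k t)"]])
      (simp add: cinner_add_right cinner_smult_right d)
  also have "\<dots> = complex_of_real (cos t * cos t + sin t * sin t)" using jk by (simp add: rot_coeff_def del: sin_cos_squared_add3)
  finally show ?thesis by (simp only: sin_cos_squared_add3 of_real_1)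
qed

text \<open>Equal weights make the part of the state in this plane maximally entangled: the
  amplitude is \<open>c k\<close> times \<open>cos s * cos t + sin s * sin t\<close> and depends on
  the angle difference alone. Both marginals minus twice the joint value then leave a multiple of a
  squared sine, quadratic in the angle.\<close>

lemma schmidt_corr_rotated:
  assumes e: "orthonormal d m e" and jk: "j < m" "k < m" "j \<noteq> k" and c: "c j = c k"
  shows "schmidt_corr m c e (outer (rotated e j k s)) (outer (rotated (unit_vec m) j k t))
      = complex_of_real ((c k)\<^sup>2 * (cos (s - t))\<^sup>2)"
    and "schmidt_corr m c e (outer (rotated e j k s)) (1\<^sub>m m) = complex_of_real ((c k)\<^sup>2)"
    and "schmidt_corr m c e (1\<^sub>m d) (outer (rotated (unit_vec m) j k t)) = complex_of_real ((c k)\<^sup>2)"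
proof -
  have ec: "\<And>j. j < m \<Longrightarrow> e j \<in> carrier_vec d" using e by (auto simp: orthonormal_def)
  let ?u = "rotated e j k s" and ?w = "rotated (unit_vec m) j k t"
  have u: "?u \<in> carrier_vec d" and w: "?w \<in> carrier_vec m"
    using rotated_carrier[OF e jk(1,2)] rotated_carrier[OF orthonormal_unit_vec jk(1,2)] by auto
  have "(\<Sum>i<m. complex_of_real (c i) * ?w $ i * cinner (e i) ?u)
      = complex_of_real (\<Sum>i<m. c i * (rot_coeff j k t i * rot_coeff j k s i))"
    by (simp add: cinner_rotated[OF e jk] rotated_unit_vec_index[OF jk] mult_ac)
  also have "\<dots> = complex_of_real (c k * cos (s - t))"
    unfolding sum_rot_coeff[OF jk] using c by (simp add: cos_diff algebra_simps)
  finally show "schmidt_corr m c e (outer ?u) (outer ?w) = complex_of_real ((c k)\<^sup>2 * (cos (s - t))\<^sup>2)"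
    by (simp add: schmidt_corr_outer[OF ec u w] power2_eq_square)
  have "schmidt_corr m c e (outer ?u) (1\<^sub>m m)
      = complex_of_real (\<Sum>i<m. (c i)\<^sup>2 * (rot_coeff j k s i * rot_coeff j k s i))"
    unfolding schmidt_corr_one_right of_real_sum
    by (rule sum.cong) (simp_all add: cinner_outer[OF u ec ec] cinner_rotated[OF e jk])
  also have "\<dots> = complex_of_real ((c k)\<^sup>2 * (cos s * cos s + sin s * sin s))"
    unfolding sum_rot_coeff[OF jk] by (simp only: c distrib_left)
  finally show "schmidt_corr m c e (outer ?u) (1\<^sub>m m) = complex_of_real ((c k)\<^sup>2)"
    by (simp only: sin_cos_squared_add3 mult_1_right)
  have "schmidt_corr m c e (1\<^sub>m d) (outer ?w)
      = complex_of_real (\<Sum>i<m. (c i)\<^sup>2 * (rot_coeff j k t i * rot_coeff j k t i))"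
    unfolding schmidt_corr_one_left[OF e] of_real_sum
    by (rule sum.cong) (use w in \<open>simp_all add: outer_def rotated_unit_vec_index[OF jk]\<close>)
  also have "\<dots> = complex_of_real ((c k)\<^sup>2 * (cos t * cos t + sin t * sin t))"
    unfolding sum_rot_coeff[OF jk] by (simp only: c distrib_left)
  finally show "schmidt_corr m c e (1\<^sub>m d) (outer ?w) = complex_of_real ((c k)\<^sup>2)"
    by (simp only: sin_cos_squared_add3 mult_1_right)
qed

subsection \<open>Markov kernels\<close>

lemma kernel_prob_space:
  assumes "K \<in> L \<rightarrow>\<^sub>M prob_algebra N" "l \<in> space L"
  shows "prob_space (K l)" "sets (K l) = sets N" "space (K l) = space N"
  using measurable_space[OF assms] sets_eq_imp_space_eq by (auto simp: space_prob_algebra)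

text \<open>Boundedness makes \<open>f\<close> integrable for each \<open>K l\<close>, so the
  nonnegative integrals, for which the formula holds without integrability, can be turned back into
  real ones.\<close>

lemma integral_bind_bounded:
  fixes f :: "'a \<Rightarrow> real"
  assumes M: "M \<in> space (prob_algebra L)" and K: "K \<in> L \<rightarrow>\<^sub>M prob_algebra N"
    and f: "f \<in> borel_measurable N" and bd: "\<And>x. x \<in> space N \<Longrightarrow> 0 \<le> f x \<and> f x \<le> B"
  shows "(\<integral>x. f x \<partial>(M \<bind> K)) = (\<integral>l. (\<integral>x. f x \<partial>K l) \<partial>M)"
    and "(\<lambda>l. \<integral>x. f x \<partial>K l) \<in> borel_measurable L"
proof -
  have sM: "sets M = sets L" "space M = space L"
    using M sets_eq_imp_space_eq by (auto simp: space_prob_algebra)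
  have K': "K \<in> L \<rightarrow>\<^sub>M subprob_algebra N" by (rule measurable_prob_algebraD[OF K])
  note Kl = kernel_prob_space(1,2)[OF K] and spK = kernel_prob_space(3)[OF K]
  show meas: "(\<lambda>l. \<integral>x. f x \<partial>K l) \<in> borel_measurable L"
    by (rule measurable_compose[OF K' integral_measurable_subprob_algebra[OF f]])
  have sb: "sets (M \<bind> K) = sets N" by (rule sets_bind'[OF M K])
  have spb: "space (M \<bind> K) = space N" using sets_eq_imp_space_eq[OF sb] .
  have nn: "0 \<le> (\<integral>x. f x \<partial>K l)" if "l \<in> space L" for l
    by (rule integral_nonneg_AE, rule AE_I2) (use bd spK[OF that] in auto)
  have "(\<integral>\<^sup>+x. f x \<partial>(M \<bind> K)) = (\<integral>\<^sup>+l. (\<integral>\<^sup>+x. f x \<partial>K l) \<partial>M)"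
    by (rule nn_integral_bind[of _ N]) (use f K' sM in \<open>auto cong: measurable_cong_sets\<close>)
  also have "\<dots> = (\<integral>\<^sup>+l. ennreal (\<integral>x. f x \<partial>K l) \<partial>M)"
  proof (rule nn_integral_cong)
    fix l assume "l \<in> space M"
    then have l: "l \<in> space L" using sM by simp
    interpret prob_space "K l" using Kl[OF l] by simp
    have "integrable (K l) f"
      by (rule integrable_const_bound[of _ B])
        (use bd spK[OF l] Kl[OF l] f in \<open>auto cong: measurable_cong_sets\<close>)
    then show "(\<integral>\<^sup>+x. f x \<partial>K l) = ennreal (\<integral>x. f x \<partial>K l)"
      by (rule nn_integral_eq_integral) (use bd spK[OF l] in auto)
  qed
  finally have eq: "(\<integral>\<^sup>+x. f x \<partial>(M \<bind> K)) = (\<integral>\<^sup>+l. ennreal (\<integral>x. f x \<partial>K l) \<partial>M)" .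
  have "(\<integral>x. f x \<partial>(M \<bind> K)) = enn2real (\<integral>\<^sup>+x. f x \<partial>(M \<bind> K))"
    by (rule integral_eq_nn_integral) (use bd spb sb f in \<open>auto cong: measurable_cong_sets\<close>)
  also have "\<dots> = (\<integral>l. (\<integral>x. f x \<partial>K l) \<partial>M)"
    unfolding eq
    by (rule integral_eq_nn_integral[symmetric])
      (use meas sM nn in \<open>auto cong: measurable_cong_sets\<close>)
  finally show "(\<integral>x. f x \<partial>(M \<bind> K)) = (\<integral>l. (\<integral>x. f x \<partial>K l) \<partial>M)" .
qed

text \<open>Jensen's inequality for the convex function \<open>\<bar>x - q\<bar>\<close>, applied to
  each \<open>K l\<close> and then integrated. It is used with an ancilla kernel, where
  \<open>h\<close> is a response of the smaller system, and with a transformation kernel, where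
  \<open>h = f\<close>.\<close>

lemma mean_deviation_bind_le:
  fixes f h :: "'a \<Rightarrow> real"
  assumes M: "M \<in> space (prob_algebra L)" and K: "K \<in> L \<rightarrow>\<^sub>M prob_algebra N"
    and f: "f \<in> borel_measurable N" and bd: "\<And>x. x \<in> space N \<Longrightarrow> 0 \<le> f x \<and> f x \<le> 1"
    and h: "AE l in M. h l = (\<integral>x. f x \<partial>K l)" and hm: "h \<in> borel_measurable L"
  shows "(\<integral>l. \<bar>h l - q\<bar> \<partial>M) \<le> (\<integral>x. \<bar>f x - q\<bar> \<partial>(M \<bind> K))"
proof -
  define B where "B = 1 + \<bar>q\<bar>"
  have bd': "0 \<le> \<bar>f x - q\<bar> \<and> \<bar>f x - q\<bar> \<le> B" if "x \<in> space N" for x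
    using bd[OF that] unfolding B_def by linarith
  have fm: "(\<lambda>x. \<bar>f x - q\<bar>) \<in> borel_measurable N" using f by simp
  note * = integral_bind_bounded[OF M K fm bd']
  have sM: "sets M = sets L" "space M = space L" and pM: "prob_space M"
    using M sets_eq_imp_space_eq by (auto simp: space_prob_algebra)
  interpret prob_space M by (rule pM)
  have inK: "\<bar>(\<integral>x. f x \<partial>K l) - q\<bar> \<le> (\<integral>x. \<bar>f x - q\<bar> \<partial>K l)"
    "0 \<le> (\<integral>x. \<bar>f x - q\<bar> \<partial>K l)" "(\<integral>x. \<bar>f x - q\<bar> \<partial>K l) \<le> B" if l: "l \<in> space L" for l
  proof -
    note Kl = kernel_prob_space[OF K l]
    note sp = Kl(3)
    interpret K: prob_space "K l" by (rule Kl)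
    have i1: "integrable (K l) f"
      by (rule K.integrable_const_bound[of _ 1]) (use bd sp Kl f in \<open>auto cong: measurable_cong_sets\<close>)
    have "(\<integral>x. f x \<partial>K l) - q = (\<integral>x. f x - q \<partial>K l)" using i1 by (simp add: K.prob_space)
    then show "\<bar>(\<integral>x. f x \<partial>K l) - q\<bar> \<le> (\<integral>x. \<bar>f x - q\<bar> \<partial>K l)"
      using integral_norm_bound[of "K l" "\<lambda>x. f x - q"] by simp
    show "0 \<le> (\<integral>x. \<bar>f x - q\<bar> \<partial>K l)" by simp
    have "integrable (K l) (\<lambda>x. \<bar>f x - q\<bar>)" using i1 by simp
    then show "(\<integral>x. \<bar>f x - q\<bar> \<partial>K l) \<le> B"
      by (rule K.integral_le_const) (use bd' sp in auto)
  qed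
  have hM: "h \<in> borel_measurable M" using hm sM by (simp cong: measurable_cong_sets)
  have kM: "(\<lambda>l. \<integral>x. \<bar>f x - q\<bar> \<partial>K l) \<in> borel_measurable M"
    using *(2) sM by (simp cong: measurable_cong_sets)
  have le: "AE l in M. \<bar>h l - q\<bar> \<le> (\<integral>x. \<bar>f x - q\<bar> \<partial>K l)"
    using h AE_space by eventually_elim (use inK sM in auto)
  have ik: "integrable M (\<lambda>l. \<integral>x. \<bar>f x - q\<bar> \<partial>K l)"
    by (rule integrable_const_bound[of _ B]) (use inK sM kM in auto)
  have "(\<integral>l. \<bar>h l - q\<bar> \<partial>M) \<le> (\<integral>l. (\<integral>x. \<bar>f x - q\<bar> \<partial>K l) \<partial>M)"
    by (rule integral_mono_AE'[OF ik le]) simp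
  then show ?thesis using *(1) by simp
qed

subsection \<open>Ontic models and local correlations\<close>

locale complete_model =
  fixes C :: "('s,'p,'m,'t,'l) com"
  assumes complete: "complete_ontic_model C"
begin

lemma system: "quantum_system C s" "ontic_model C s"
  and composition: "composition C s1 s2" and locals: "local_measurements C s1 s2"
  and system_of_dim: "n \<ge> 1 \<Longrightarrow> \<exists>s. sdim C s = n"
  using complete by (auto simp: complete_ontic_model_def)

lemma sdim_pos: "sdim C s \<ge> 1"
  using system(1)[of s] by (simp add: quantum_system_def Let_def)

lemma sdim_joint: "sdim C (joint C s1 s2) = sdim C s1 * sdim C s2"
  using composition by (simp add: composition_def Let_def)

lemma rho_density: "P \<in> Prep C s \<Longrightarrow> density (sdim C s) (rho C s P)"
  and ex_Prep: "density (sdim C s) r \<Longrightarrow> \<exists>P\<in>Prep C s. rho C s P = r"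
  and obs_self_adjoint: "m \<in> Meas C s \<Longrightarrow> self_adjoint (sdim C s) (obs C s m)"
  and ex_Meas: "self_adjoint (sdim C s) A \<Longrightarrow> \<exists>m\<in>Meas C s. obs C s m = A"
  and ex_Trans: "unitary (sdim C s) U \<Longrightarrow> \<exists>T\<in>Trans C s. uni C s T = U"
proof -
  have "rho C s ` Prep C s = {\<rho>. density (sdim C s) \<rho>}" "obs C s ` Meas C s = {A. self_adjoint (sdim C s) A}"
    "uni C s ` Trans C s = {U. unitary (sdim C s) U}"
    using system(1)[of s] unfolding quantum_system_def Let_def by auto
  then show "P \<in> Prep C s \<Longrightarrow> density (sdim C s) (rho C s P)"
    "density (sdim C s) r \<Longrightarrow> \<exists>P\<in>Prep C s. rho C s P = r"
    "m \<in> Meas C s \<Longrightarrow> self_adjoint (sdim C s) (obs C s m)"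
    "self_adjoint (sdim C s) A \<Longrightarrow> \<exists>m\<in>Meas C s. obs C s m = A"
    "unitary (sdim C s) U \<Longrightarrow> \<exists>T\<in>Trans C s. uni C s T = U"
    by (metis (no_types, lifting) image_iff mem_Collect_eq)+
qed

lemma mu_prob: "P \<in> Prep C s \<Longrightarrow> mu C s P \<in> space (prob_algebra (Lam C s))"
  and gam_kernel: "T \<in> Trans C s \<Longrightarrow> gam C s T \<in> Lam C s \<rightarrow>\<^sub>M prob_algebra (Lam C s)"
  and resp_fn: "m \<in> Meas C s \<Longrightarrow> response_fn (Lam C s) (sdim C s) (obs C s m) (resp C s m)"
  using system(2)[of s] by (auto simp: ontic_model_def Let_def)

lemma resp_measurable: "m \<in> Meas C s \<Longrightarrow> resp C s m a \<in> borel_measurable (Lam C s)"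
  using resp_fn by (auto simp: response_fn_def)

lemma resp_sum_le_one:
  assumes m: "m \<in> Meas C s" and l: "l \<in> space (Lam C s)" and Y: "finite Y"
  shows "(\<Sum>a\<in>Y. resp C s m a l) \<le> 1"
proof -
  let ?V = "eigvals (sdim C s) (obs C s m)"
  have R: "\<And>a. 0 \<le> resp C s m a l" "\<And>a. a \<notin> ?V \<Longrightarrow> resp C s m a l = 0" "(\<Sum>a\<in>?V. resp C s m a l) = 1"
    using resp_fn[OF m] l by (auto simp: response_fn_def)
  \<comment> \<open>A sum over an infinite set is 0 by default, and this one is 1.\<close>
  have "finite ?V" using R(3) sum.infinite by (metis zero_neq_one)
  have "(\<Sum>a\<in>Y. resp C s m a l) = (\<Sum>a\<in>Y \<inter> ?V. resp C s m a l)"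
    by (rule sum.mono_neutral_right) (use Y R in auto)
  also have "\<dots> \<le> (\<Sum>a\<in>?V. resp C s m a l)"
    by (rule sum_mono2) (use \<open>finite ?V\<close> R in auto)
  finally show ?thesis using R by simp
qed

lemma resp_bounds:
  assumes "m \<in> Meas C s" "l \<in> space (Lam C s)"
  shows "0 \<le> resp C s m a l" "resp C s m a l \<le> 1"
  using resp_fn[OF assms(1)] assms(2) resp_sum_le_one[OF assms, of "{a}"]
  by (auto simp: response_fn_def)

text \<open>Prescribed on all measurable sets, the measure of the joint preparation is the bind of
  \<open>mu C s1 P1\<close> with the ancilla kernel, and ancilla independence makes the old response
  the average of the new one: the situation of \<open>mean_deviation_bind_le\<close>.\<close>

lemma ancilla_transfer:
  assumes anc: "ancilla_independence C"
    and P1: "P1 \<in> Prep C s1" and P2: "P2 \<in> Prep C s2" and m: "m \<in> Meas C s1"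
  obtains m' P where "m' \<in> Meas C (joint C s1 s2)" "P \<in> Prep C (joint C s1 s2)"
    "obs C (joint C s1 s2) m' = kron (obs C s1 m) (1\<^sub>m (sdim C s2))"
    "rho C (joint C s1 s2) P = kron (rho C s1 P1) (rho C s2 P2)"
    "\<And>a q. a \<in> eigvals (sdim C s1) (obs C s1 m) \<Longrightarrow>
       (\<integral>l. \<bar>resp C s1 m a l - q\<bar> \<partial>mu C s1 P1) \<le> (\<integral>l. \<bar>resp C (joint C s1 s2) m' a l - q\<bar> \<partial>mu C (joint C s1 s2) P)"
proof -
  let ?J = "joint C s1 s2" and ?K = "anc C s1 s2 P2"
  obtain m' where m': "m' \<in> Meas C ?J" "obs C ?J m' = kron (obs C s1 m) (1\<^sub>m (sdim C s2))"
    and av: "\<And>a l. a \<in> eigvals (sdim C s1) (obs C s1 m) \<Longrightarrow> l \<in> space (Lam C s1) \<Longrightarrow>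
          resp C s1 m a l = (\<integral>l'. resp C ?J m' a l' \<partial>?K l)"
    using anc m P2 unfolding ancilla_independence_def Let_def by meson
  have K: "?K \<in> Lam C s1 \<rightarrow>\<^sub>M prob_algebra (Lam C ?J)"
    and "\<exists>P\<in>Prep C ?J. rho C ?J P = kron (rho C s1 P1) (rho C s2 P2) \<and>
           (\<forall>\<Delta>\<in>sets (Lam C ?J). measure (mu C ?J P) \<Delta> = (\<integral>l. measure (?K l) \<Delta> \<partial>mu C s1 P1))"
    using composition[of s1 s2] P1 P2 unfolding composition_def Let_def by blast+
  then obtain P where P: "P \<in> Prep C ?J" "rho C ?J P = kron (rho C s1 P1) (rho C s2 P2)"
    and eq: "\<And>\<Delta>. \<Delta> \<in> sets (Lam C ?J) \<Longrightarrow> measure (mu C ?J P) \<Delta> = (\<integral>l. measure (?K l) \<Delta> \<partial>mu C s1 P1)"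
    by blast
  have M: "mu C s1 P1 \<in> space (prob_algebra (Lam C s1))" by (rule mu_prob[OF P1])
  have sM: "sets (mu C s1 P1) = sets (Lam C s1)" "space (mu C s1 P1) = space (Lam C s1)"
    using M sets_eq_imp_space_eq by (auto simp: space_prob_algebra)
  have muP: "sets (mu C ?J P) = sets (Lam C ?J)" "prob_space (mu C ?J P)"
    using mu_prob[OF P(1)] by (auto simp: space_prob_algebra)
  have bind: "mu C ?J P = mu C s1 P1 \<bind> ?K"
  proof (rule measure_eqI)
    show "sets (mu C ?J P) = sets (mu C s1 P1 \<bind> ?K)" using sets_bind'[OF M K] muP by simp
    fix X assume "X \<in> sets (mu C ?J P)"
    then have X: "X \<in> sets (Lam C ?J)" using muP by simp
    interpret J: prob_space "mu C ?J P" by (rule muP)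
    interpret b: prob_space "mu C s1 P1 \<bind> ?K" by (rule prob_space_bind'[OF M K])
    have ind: "indicator X \<in> borel_measurable (Lam C ?J)" using X by simp
    have "measure (mu C s1 P1 \<bind> ?K) X = (\<integral>x. indicator X x \<partial>(mu C s1 P1 \<bind> ?K))"
      using X sets_bind'[OF M K] by (simp add: sets.sets_into_space sets.Int_space_eq2)
    also have "\<dots> = (\<integral>l. (\<integral>x. indicator X x \<partial>?K l) \<partial>mu C s1 P1)"
      by (rule integral_bind_bounded(1)[OF M K, where B=1]) (use ind in \<open>auto split: split_indicator\<close>)
    also have "\<dots> = (\<integral>l. measure (?K l) X \<partial>mu C s1 P1)"
    proof (rule Bochner_Integration.integral_cong[OF refl])
      fix l assume "l \<in> space (mu C s1 P1)"
      then have "sets (?K l) = sets (Lam C ?J)"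
        using measurable_space[OF K, of l] sM by (simp add: space_prob_algebra)
      then show "(\<integral>x. indicator X x \<partial>?K l) = measure (?K l) X"
        using X by (simp add: sets.Int_space_eq2)
    qed
    finally have "measure (mu C s1 P1 \<bind> ?K) X = measure (mu C ?J P) X" using eq[OF X] by simp
    then show "emeasure (mu C ?J P) X = emeasure (mu C s1 P1 \<bind> ?K) X"
      by (simp add: J.emeasure_eq_measure b.emeasure_eq_measure)
  qed
  have "(\<integral>l. \<bar>resp C s1 m a l - q\<bar> \<partial>mu C s1 P1) \<le> (\<integral>l. \<bar>resp C ?J m' a l - q\<bar> \<partial>mu C ?J P)"
    if "a \<in> eigvals (sdim C s1) (obs C s1 m)" for a q
  proof -
    have ae: "AE l in mu C s1 P1. resp C s1 m a l = (\<integral>l'. resp C ?J m' a l' \<partial>?K l)"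
      using av[OF that] sM by (intro AE_I2) simp
    show ?thesis
      unfolding bind
      by (rule mean_deviation_bind_le[OF M K resp_measurable[OF m'(1)] _ ae resp_measurable[OF m]])
        (use resp_bounds[OF m'(1)] in auto)
  qed
  then show thesis using that m' P by blast
qed

text \<open>The statistics of \<open>\<sigma>\<close> for a measure that, like a bind with a
  transformation kernel, need not come from any preparation.\<close>

definition reproduces :: "'s \<Rightarrow> 's \<Rightarrow> 'l measure \<Rightarrow> complex mat \<Rightarrow> bool" where
  "reproduces s1 s2 N \<sigma> \<longleftrightarrow> (let J = joint C s1 s2 in
     N \<in> space (prob_algebra (Lam C J)) \<and>
     (\<forall>m\<in>Meas C J. \<forall>a\<in>eigvals (sdim C J) (obs C J m).
        complex_of_real (\<integral>l. resp C J m a l \<partial>N) = tr (\<sigma> * eigproj (sdim C J) (obs C J m) a)) \<and>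
     (\<forall>m A B. product_measurement C s1 s2 m A B \<longrightarrow>
        (\<forall>a\<in>eigvals (sdim C s1) A. \<forall>b\<in>eigvals (sdim C s2) B.
           complex_of_real (\<integral>l. presp C s1 s2 m (a,b) l \<partial>N)
             = tr (\<sigma> * kron (eigproj (sdim C s1) A a) (eigproj (sdim C s2) B b)))))"

lemma reproducesD:
  assumes "reproduces s1 s2 N \<sigma>"
  shows "m \<in> Meas C (joint C s1 s2) \<Longrightarrow> a \<in> eigvals (sdim C (joint C s1 s2)) (obs C (joint C s1 s2) m) \<Longrightarrow>
      complex_of_real (\<integral>l. resp C (joint C s1 s2) m a l \<partial>N)
        = tr (\<sigma> * eigproj (sdim C (joint C s1 s2)) (obs C (joint C s1 s2) m) a)"
    and "product_measurement C s1 s2 m A B \<Longrightarrow> a \<in> eigvals (sdim C s1) A \<Longrightarrow> b \<in> eigvals (sdim C s2) B \<Longrightarrow>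
      complex_of_real (\<integral>l. presp C s1 s2 m (a,b) l \<partial>N)
        = tr (\<sigma> * kron (eigproj (sdim C s1) A a) (eigproj (sdim C s2) B b))"
  using assms unfolding reproduces_def Let_def by blast+

lemma presp_measurable:
  "product_measurement C s1 s2 m A B \<Longrightarrow> presp C s1 s2 m ab \<in> borel_measurable (Lam C (joint C s1 s2))"
  unfolding product_measurement_def Let_def by blast

lemma presp_bounds:
  assumes pm: "product_measurement C s1 s2 m A B" and l: "l \<in> space (Lam C (joint C s1 s2))"
  shows "0 \<le> presp C s1 s2 m ab l" "presp C s1 s2 m ab l \<le> 1"
    and "finite (eigvals (sdim C s1) A)" "finite (eigvals (sdim C s2) B)"
proof -
  let ?V = "eigvals (sdim C s1) A" and ?W = "eigvals (sdim C s2) B"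
  have R: "\<And>ab. 0 \<le> presp C s1 s2 m ab l" "\<And>ab. ab \<notin> ?V \<times> ?W \<Longrightarrow> presp C s1 s2 m ab l = 0"
    "(\<Sum>ab\<in>?V \<times> ?W. presp C s1 s2 m ab l) = 1"
    using pm l unfolding product_measurement_def Let_def by blast+
  \<comment> \<open>The sum 1 excludes an infinite product as well as an empty one; nonemptiness is
    what passes finiteness on to the factors.\<close>
  have fin: "finite (?V \<times> ?W)" "?V \<times> ?W \<noteq> {}" using R(3) by (auto intro: ccontr)
  then show "finite ?V" "finite ?W" by (auto dest: finite_cartesian_productD1 finite_cartesian_productD2)
  show "0 \<le> presp C s1 s2 m ab l" by (rule R)
  show "presp C s1 s2 m ab l \<le> 1"
  proof (cases "ab \<in> ?V \<times> ?W")
    case True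
    then show ?thesis using member_le_sum[OF True, of "\<lambda>ab. presp C s1 s2 m ab l"] R fin by auto
  qed (use R in auto)
qed

text \<open>These are the clauses of the model on transformed states, with their iterated integrals
  read as one integral over the bind.\<close>

lemma reproduces_evolved:
  assumes P: "P \<in> Prep C (joint C s1 s2)" and T: "T \<in> Trans C (joint C s1 s2)"
  shows "reproduces s1 s2 (mu C (joint C s1 s2) P \<bind> gam C (joint C s1 s2) T)
    (uni C (joint C s1 s2) T * rho C (joint C s1 s2) P * adj (uni C (joint C s1 s2) T))"
proof -
  let ?J = "joint C s1 s2"
  note M = mu_prob[OF P] and K = gam_kernel[OF T]
  have 1: "(\<integral>x. resp C ?J m a x \<partial>(mu C ?J P \<bind> gam C ?J T)) = (\<integral>lt. (\<integral>l. resp C ?J m a l \<partial>gam C ?J T lt) \<partial>mu C ?J P)"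
    if "m \<in> Meas C ?J" for m a
    by (rule integral_bind_bounded(1)[OF M K resp_measurable[OF that], where B=1]) (use resp_bounds[OF that] in auto)
  have 2: "(\<integral>x. presp C s1 s2 m ab x \<partial>(mu C ?J P \<bind> gam C ?J T)) = (\<integral>lt. (\<integral>l. presp C s1 s2 m ab l \<partial>gam C ?J T lt) \<partial>mu C ?J P)"
    if "product_measurement C s1 s2 m A B" for m ab A B
    by (rule integral_bind_bounded(1)[OF M K, where B=1])
      (use presp_bounds[OF that] presp_measurable[OF that] in auto)
  have "mu C ?J P \<bind> gam C ?J T \<in> space (prob_algebra (Lam C ?J))"
    using sets_bind'[OF M K] prob_space_bind'[OF M K] by (simp add: space_prob_algebra)
  then show ?thesis
    using P T system(2)[of ?J] unfolding reproduces_def Let_def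
    by (simp add: 1 2 ontic_model_def, simp add: 2 product_measurement_def Let_def)
qed

text \<open>For a single outcome pair the joint response is at most either marginal, so the distance of the
  marginals is controlled by their excess over the joint response.\<close>
lemma local_correlation:
  assumes pind: "parameter_independence C" and N: "reproduces s1 s2 N \<sigma>"
    and A: "self_adjoint (sdim C s1) A" and B: "self_adjoint (sdim C s2) B"
    and m1: "m1 \<in> Meas C (joint C s1 s2)" "obs C (joint C s1 s2) m1 = kron A (1\<^sub>m (sdim C s2))"
    and m2: "m2 \<in> Meas C (joint C s1 s2)" "obs C (joint C s1 s2) m2 = kron (1\<^sub>m (sdim C s1)) B"
    and a: "a \<in> eigvals (sdim C s1) A" and Y: "Y \<subseteq> eigvals (sdim C s2) B"
  defines "E \<equiv> eigproj (sdim C s1) A a" and "F \<equiv> eigproj (sdim C s2) B"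
  shows "(\<integral>l. \<bar>resp C (joint C s1 s2) m1 a l - (\<Sum>b\<in>Y. resp C (joint C s1 s2) m2 b l)\<bar> \<partial>N)
    \<le> Re (tr (\<sigma> * kron E (1\<^sub>m (sdim C s2)))) + (\<Sum>b\<in>Y. Re (tr (\<sigma> * kron (1\<^sub>m (sdim C s1)) (F b))))
      - 2 * (\<Sum>b\<in>Y. Re (tr (\<sigma> * kron E (F b))))"
proof -
  let ?J = "joint C s1 s2" and ?n1 = "sdim C s1" and ?n2 = "sdim C s2"
  let ?V = "eigvals ?n1 A" and ?W = "eigvals ?n2 B"
  have Ac: "A \<in> carrier_mat ?n1 ?n1" and Bc: "B \<in> carrier_mat ?n2 ?n2"
    using A B by (auto simp: self_adjoint_def)
  obtain m where m: "m \<in> prodM C s1 s2" "locs C s1 s2 m = (m1, m2)"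
    using locals[of s1 s2] A B m1 m2 unfolding local_measurements_def Let_def by blast
  then obtain A' B' where A': "self_adjoint ?n1 A'" "obs C ?J m1 = kron A' (1\<^sub>m ?n2)"
    and B': "self_adjoint ?n2 B'" "obs C ?J m2 = kron (1\<^sub>m ?n1) B'"
    and pm': "product_measurement C s1 s2 m A' B'"
    using locals[of s1 s2] unfolding local_measurements_def Let_def by fastforce
  \<comment> \<open>The factors attached to \<open>m\<close> are not a priori the given ones; the
    operators of the shared local procedures identify them.\<close>
  have "A' = A" using kron_one_inject(1)[of A' ?n1 A ?n2] A A' m1 sdim_pos by (auto simp: self_adjoint_def)
  moreover have "B' = B" using kron_one_inject(2)[of B' ?n2 B ?n1] B B' m2 sdim_pos by (auto simp: self_adjoint_def)
  ultimately have pm: "product_measurement C s1 s2 m A B" using pm' by simp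
  let ?p = "presp C s1 s2 m" and ?r1 = "resp C ?J m1" and ?r2 = "resp C ?J m2"
  have r1: "?r1 a l = (\<Sum>b\<in>?W. ?p (a,b) l)" and r2: "b \<in> ?W \<Longrightarrow> ?r2 b l = (\<Sum>a\<in>?V. ?p (a,b) l)"
    if "l \<in> space (Lam C ?J)" for l b
    using pind m A B m1 m2 a that unfolding parameter_independence_def Let_def by force+
  have NN: "sets N = sets (Lam C ?J)" "prob_space N"
    using N unfolding reproduces_def Let_def space_prob_algebra by blast+
  have rep1: "(\<integral>l. resp C ?J m a l \<partial>N) = Re (tr (\<sigma> * eigproj (sdim C ?J) (obs C ?J m) a))"
    if "m \<in> Meas C ?J" "a \<in> eigvals (sdim C ?J) (obs C ?J m)" for m a
    using reproducesD(1)[OF N that] by (metis Re_complex_of_real)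
  have rep2: "(\<integral>l. ?p (a,b) l \<partial>N) = Re (tr (\<sigma> * kron (eigproj ?n1 A a) (eigproj ?n2 B b)))"
    if "a \<in> ?V" "b \<in> ?W" for a b
    using reproducesD(2)[OF N pm that] by (metis Re_complex_of_real)
  interpret prob_space N by (rule NN)
  have sN: "space N = space (Lam C ?J)" using sets_eq_imp_space_eq[OF NN(1)] .
  \<comment> \<open>Finiteness of the spectra is read off the normalization of the responses at a
    point, and a probability space has one.\<close>
  obtain l0 where l0: "l0 \<in> space (Lam C ?J)" using not_empty sN by blast
  note fin = presp_bounds(3,4)[OF pm l0]
  have finY: "finite Y" using Y fin finite_subset by blast
  have i1: "integrable N (\<lambda>l. resp C ?J m a l)" if "m \<in> Meas C ?J" for m a
    by (rule integrable_const_bound[of _ 1])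
      (use resp_bounds[OF that] resp_measurable[OF that] sN NN in \<open>auto cong: measurable_cong_sets\<close>)
  have "\<bar>?p ab l\<bar> \<le> 1" if "l \<in> space N" for ab l
    using presp_bounds(1,2)[OF pm, of l ab] that sN by simp
  then have i2: "integrable N (?p ab)" for ab
    by (intro integrable_const_bound[of _ 1] AE_I2)
      (use presp_measurable[OF pm] sN NN in \<open>auto cong: measurable_cong_sets\<close>)
  have "\<bar>?r1 a l - (\<Sum>b\<in>Y. ?r2 b l)\<bar> \<le> ?r1 a l + (\<Sum>b\<in>Y. ?r2 b l) - 2 * (\<Sum>b\<in>Y. ?p (a,b) l)"
    if l: "l \<in> space N" for l
  proof -
    have l': "l \<in> space (Lam C ?J)" using l sN by simp
    have "(\<Sum>b\<in>Y. ?p (a,b) l) \<le> ?r1 a l"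
      unfolding r1[OF l'] by (rule sum_mono2) (use fin Y presp_bounds[OF pm l'] in auto)
    moreover have "(\<Sum>b\<in>Y. ?p (a,b) l) \<le> (\<Sum>b\<in>Y. ?r2 b l)"
    proof (rule sum_mono)
      fix b assume "b \<in> Y"
      then have b: "b \<in> ?W" using Y by auto
      show "?p (a,b) l \<le> ?r2 b l"
        unfolding r2[OF l' b] by (rule member_le_sum) (use fin a presp_bounds[OF pm l'] in auto)
    qed
    ultimately show ?thesis by linarith
  qed
  then have "(\<integral>l. \<bar>?r1 a l - (\<Sum>b\<in>Y. ?r2 b l)\<bar> \<partial>N)
      \<le> (\<integral>l. ?r1 a l + (\<Sum>b\<in>Y. ?r2 b l) - 2 * (\<Sum>b\<in>Y. ?p (a,b) l) \<partial>N)"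
    using i1[OF m1(1)] i1[OF m2(1)] i2 by (intro integral_mono) auto
  also have "\<dots> = (\<integral>l. ?r1 a l \<partial>N) + (\<Sum>b\<in>Y. (\<integral>l. ?r2 b l \<partial>N)) - 2 * (\<Sum>b\<in>Y. (\<integral>l. ?p (a,b) l \<partial>N))"
    using i1[OF m1(1)] i1[OF m2(1)] i2 by simp
  also have "(\<integral>l. ?r1 a l \<partial>N) = Re (tr (\<sigma> * kron E (1\<^sub>m ?n2)))"
    using rep1[OF m1(1), of a] a
    by (simp add: m1(2) sdim_joint eigvals_kron_one[OF Ac sdim_pos] eigproj_kron_one[OF Ac] E_def)
  also have "(\<Sum>b\<in>Y. (\<integral>l. ?r2 b l \<partial>N)) = (\<Sum>b\<in>Y. Re (tr (\<sigma> * kron (1\<^sub>m ?n1) (F b))))"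
  proof (rule sum.cong[OF refl])
    fix b assume "b \<in> Y"
    then have "b \<in> ?W" using Y by auto
    then show "(\<integral>l. ?r2 b l \<partial>N) = Re (tr (\<sigma> * kron (1\<^sub>m ?n1) (F b)))"
      using rep1[OF m2(1), of b]
      by (simp add: m2(2) sdim_joint eigvals_one_kron[OF Bc sdim_pos] eigproj_one_kron[OF Bc] F_def)
  qed
  also have "(\<Sum>b\<in>Y. (\<integral>l. ?p (a,b) l \<partial>N)) = (\<Sum>b\<in>Y. Re (tr (\<sigma> * kron E (F b))))"
    by (rule sum.cong[OF refl]) (use rep2[OF a] Y in \<open>auto simp: E_def F_def\<close>)
  finally show ?thesis .
qed

end

lemma eigvals_outer:
  assumes w: "w \<in> carrier_vec n" "cinner w w = 1"
  shows "eigproj n (outer w) 1 = outer w" "1 \<in> eigvals n (outer w)"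
proof -
  show *: "eigproj n (outer w) 1 = outer w"
    by (rule eigproj_projection[OF outer_carrier[OF w(1)] adj_outer outer_idem[OF w]])
  have "tr (outer w) \<noteq> tr (0\<^sub>m n n)" using w by (simp add: tr_outer tr_def[of "0\<^sub>m n n"])
  then have "outer w \<noteq> 0\<^sub>m n n" by metis
  then show "1 \<in> eigvals n (outer w)" using eigvals_iff[OF outer_carrier[OF w(1)], of 1] * by simp
qed

subsection \<open>The chained Bell argument\<close>

text \<open>Equal totals make \<open>g * (\<alpha> - \<beta>)\<close> a difference of the tails
  outside \<open>G\<close>, and \<open>S\<close> collects only \<open>h \<le> g\<close> copies of
  \<open>\<alpha> - \<beta>\<close>; the rest of \<open>S\<close> lies in the tails.\<close>

lemma subset_sum_gap:
  fixes y w :: "nat \<Rightarrow> real"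
  assumes I: "finite I" "S \<subseteq> I" "G \<subseteq> I" and nn: "\<And>i. i \<in> I \<Longrightarrow> 0 \<le> y i" "\<And>i. i \<in> I \<Longrightarrow> 0 \<le> w i"
    and y: "sum y I = 1" "\<And>i j. i \<in> G \<Longrightarrow> j \<in> G \<Longrightarrow> y i = y j"
    and w: "sum w I = 1" "\<And>i j. i \<in> G \<Longrightarrow> j \<in> G \<Longrightarrow> w i = w j"
  shows "\<bar>sum y S - sum w S\<bar> \<le> sum y (I - G) + sum w (I - G)"
proof -
  obtain \<alpha> where \<alpha>: "\<And>i. i \<in> G \<Longrightarrow> y i = \<alpha>" using y(2) by metis
  obtain \<beta> where \<beta>: "\<And>i. i \<in> G \<Longrightarrow> w i = \<beta>" using w(2) by metis
  have fin: "finite S" "finite G" using I finite_subset by auto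
  define h g where "h = real (card (S \<inter> G))" and "g = real (card G)"
  have hg: "0 \<le> h" "h \<le> g" using fin by (auto simp: h_def g_def intro: card_mono)
  have split: "sum f S = sum f (S \<inter> G) + sum f (S - G)" "sum f I = sum f G + sum f (I - G)" for f :: "nat \<Rightarrow> real"
    using sum.Int_Diff[OF fin(1), of f G] sum.subset_diff[OF I(3,1), of f] by auto
  have cs: "sum y (S \<inter> G) = h * \<alpha>" "sum w (S \<inter> G) = h * \<beta>" "sum y G = g * \<alpha>" "sum w G = g * \<beta>"
    using \<alpha> \<beta> by (auto simp: h_def g_def)
  have le: "sum y (S - G) \<le> sum y (I - G)" "sum w (S - G) \<le> sum w (I - G)" "0 \<le> sum y (S - G)" "0 \<le> sum w (S - G)"
    using I nn by (auto intro!: sum_mono2 sum_nonneg)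
  have tot: "g * \<alpha> + sum y (I - G) = 1" "g * \<beta> + sum w (I - G) = 1" using y(1) w(1) split(2) cs by metis+
  have "h * (\<alpha> - \<beta>) \<le> g * (\<alpha> - \<beta>) \<and> 0 \<le> h * (\<alpha> - \<beta>) \<or> h * (\<beta> - \<alpha>) \<le> g * (\<beta> - \<alpha>) \<and> 0 \<le> h * (\<beta> - \<alpha>)"
  proof (cases "\<alpha> \<ge> \<beta>")
    case True
    then show ?thesis using hg by (intro disjI1 conjI mult_right_mono mult_nonneg_nonneg) auto
  next
    case False
    then show ?thesis using hg by (intro disjI2 conjI mult_right_mono mult_nonneg_nonneg) auto
  qed
  then show ?thesis
    unfolding split(1) cs using le tot by (auto simp: algebra_simps abs_le_iff)
qed

text \<open>All that the Bell argument uses of the swapped state: its statistics, and the Schmidt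
  form of its correlations between \<open>H\<close> and the register. The last factor, which holds
  the original state, only meets identities.\<close>

locale schmidt_model = complete_model C for C :: "('s,'p,'m,'t,'l) com" +
  fixes s s' :: 's and N :: "'l measure" and \<sigma> :: "complex mat"
    and m :: nat and c :: "nat \<Rightarrow> real" and e :: "nat \<Rightarrow> complex vec"
  assumes param_indep: "parameter_independence C"
    and sdim_s': "sdim C s' = m * sdim C s"
    and rep: "reproduces s s' N \<sigma>"
    and e: "orthonormal (sdim C s) m e"
    and corr: "\<And>X Y. X \<in> carrier_mat (sdim C s) (sdim C s) \<Longrightarrow> Y \<in> carrier_mat m m \<Longrightarrow>
      tr (\<sigma> * kron X (kron Y (1\<^sub>m (sdim C s)))) = schmidt_corr m c e X Y"
begin

abbreviation d where "d \<equiv> sdim C s"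
abbreviation J where "J \<equiv> joint C s s'"

text \<open>A relation rather than a function: one operator may belong to many procedures, whose
  responses may differ. \<open>left\<close> measures \<open>H\<close>, \<open>right\<close> the
  register.\<close>

definition left :: "'m \<Rightarrow> complex mat \<Rightarrow> bool" where
  "left p A \<longleftrightarrow> p \<in> Meas C J \<and> self_adjoint d A \<and> obs C J p = kron A (1\<^sub>m (m*d))"

definition right :: "'m \<Rightarrow> complex mat \<Rightarrow> bool" where
  "right p Y \<longleftrightarrow> p \<in> Meas C J \<and> self_adjoint m Y \<and> obs C J p = kron (1\<^sub>m d) (kron Y (1\<^sub>m d))"

lemma ex_left: "self_adjoint d A \<Longrightarrow> \<exists>p. left p A"
  using ex_Meas[of J "kron A (1\<^sub>m (m*d))"] self_adjoint_kron[OF _ self_adjoint_one]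
  by (auto simp: left_def sdim_joint sdim_s')

lemma ex_right: "self_adjoint m Y \<Longrightarrow> \<exists>p. right p Y"
  using ex_Meas[of J "kron (1\<^sub>m d) (kron Y (1\<^sub>m d))"]
    self_adjoint_kron[OF self_adjoint_one self_adjoint_kron[OF _ self_adjoint_one]]
  by (auto simp: right_def sdim_joint sdim_s')

sublocale prob_space N
  using rep by (simp add: reproduces_def Let_def space_prob_algebra)

lemma sets_N: "sets N = sets (Lam C J)" and space_N: "space N = space (Lam C J)"
  using rep sets_eq_imp_space_eq by (auto simp: reproduces_def Let_def space_prob_algebra)

lemma integrable_resp: "p \<in> Meas C J \<Longrightarrow> integrable N (resp C J p a)"
  by (rule integrable_const_bound[of _ 1])
    (use resp_bounds resp_measurable in \<open>auto simp: space_N sets_N cong: measurable_cong_sets\<close>)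

lemma deviation_le:
  assumes p: "left p A" and p': "right p' Y"
    and a: "a \<in> eigvals d A" and Z: "Z \<subseteq> eigvals m Y"
  defines "E \<equiv> eigproj d A a" and "F \<equiv> eigproj m Y"
  shows "(\<integral>l. \<bar>resp C J p a l - (\<Sum>b\<in>Z. resp C J p' b l)\<bar> \<partial>N)
    \<le> Re (schmidt_corr m c e E (1\<^sub>m m)) + (\<Sum>b\<in>Z. Re (schmidt_corr m c e (1\<^sub>m d) (F b)))
      - 2 * (\<Sum>b\<in>Z. Re (schmidt_corr m c e E (F b)))"
proof -
  have A: "A \<in> carrier_mat d d" and Y: "Y \<in> carrier_mat m m"
    using p p' by (auto simp: left_def right_def self_adjoint_def)
  have E: "E \<in> carrier_mat d d" and F: "F b \<in> carrier_mat m m" for b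
    using eigproj_carrier A Y by (auto simp: E_def F_def)
  have ev: "eigvals (m*d) (kron Y (1\<^sub>m d)) = eigvals m Y"
    "eigproj (m*d) (kron Y (1\<^sub>m d)) b = kron (F b) (1\<^sub>m d)" for b
    using eigvals_kron_one[OF Y sdim_pos] eigproj_kron_one[OF Y] by (auto simp: F_def)
  have "(\<integral>l. \<bar>resp C J p a l - (\<Sum>b\<in>Z. resp C J p' b l)\<bar> \<partial>N)
    \<le> Re (tr (\<sigma> * kron E (1\<^sub>m (sdim C s')))) + (\<Sum>b\<in>Z. Re (tr (\<sigma> * kron (1\<^sub>m d) (kron (F b) (1\<^sub>m d)))))
      - 2 * (\<Sum>b\<in>Z. Re (tr (\<sigma> * kron E (kron (F b) (1\<^sub>m d)))))"
    using local_correlation[OF param_indep rep, of A "kron Y (1\<^sub>m d)" p p' a Z] p p' a Z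
      self_adjoint_kron[OF _ self_adjoint_one, of m Y d]
    by (simp add: ev left_def right_def E_def sdim_s')
  then show ?thesis
    by (simp add: corr[OF E F] corr[OF one_carrier_mat F] corr[OF E one_carrier_mat] sdim_s' kron_one[symmetric])
qed

text \<open>Two register procedures are given no joint response, so both are compared with one
  procedure on \<open>H\<close>. The observables are arbitrary apart from one eigenprojection, which
  lets a chain start and end at outcomes of \<open>diag_nat m\<close>.\<close>

lemma rotated_step:
  assumes jk: "j < m" "k < m" "j \<noteq> k" "c j = c k"
    and p: "right p Y" "b \<in> eigvals m Y" "eigproj m Y b = outer (rotated (unit_vec m) j k t)"
    and p': "right p' Y'" "b' \<in> eigvals m Y'" "eigproj m Y' b' = outer (rotated (unit_vec m) j k t')"
  shows "(\<integral>l. \<bar>resp C J p b l - resp C J p' b' l\<bar> \<partial>N) \<le> 4 * (c k)\<^sup>2 * (sin ((t - t') / 2))\<^sup>2"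
proof -
  \<comment> \<open>Halfway between the two register angles, each comparison spans only
    \<open>(t - t') / 2\<close>.\<close>
  define r where "r = (t + t') / 2"
  let ?u = "rotated e j k r"
  have u: "?u \<in> carrier_vec d" "cinner ?u ?u = 1"
    using rotated_carrier[OF e jk(1,2)] cinner_rotated_self[OF e jk(1-3)] by auto
  note ev = eigvals_outer[OF u]
  obtain p0 where p0: "left p0 (outer ?u)" using ex_left[OF self_adjoint_outer[OF u(1)]] by blast
  note sc = schmidt_corr_rotated[OF e jk]
  have b1: "(\<integral>l. \<bar>resp C J p0 1 l - resp C J p b l\<bar> \<partial>N) \<le> 2 * (c k)\<^sup>2 * (sin ((t - t') / 2))\<^sup>2"
  proof -
    have "r - t = - ((t - t') / 2)" by (simp add: r_def field_simps)
    then have "(cos (r - t))\<^sup>2 = 1 - (sin ((t - t') / 2))\<^sup>2" by (simp only: cos_minus cos_squared_eq)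
    then show ?thesis
      using deviation_le[OF p0 p(1) ev(2), of "{b}"] p(2)
      by (simp add: ev(1) p(3) sc right_diff_distrib)
  qed
  have b2: "(\<integral>l. \<bar>resp C J p0 1 l - resp C J p' b' l\<bar> \<partial>N) \<le> 2 * (c k)\<^sup>2 * (sin ((t - t') / 2))\<^sup>2"
  proof -
    have "r - t' = (t - t') / 2" by (simp add: r_def field_simps)
    then have "(cos (r - t'))\<^sup>2 = 1 - (sin ((t - t') / 2))\<^sup>2" by (simp only: cos_squared_eq)
    then show ?thesis
      using deviation_le[OF p0 p'(1) ev(2), of "{b'}"] p'(2)
      by (simp add: ev(1) p'(3) sc right_diff_distrib)
  qed
  have i: "integrable N (resp C J p0 1)" "integrable N (resp C J p b)" "integrable N (resp C J p' b')"
    using p0 p p' integrable_resp by (auto simp: left_def right_def)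
  have "(\<integral>l. \<bar>resp C J p b l - resp C J p' b' l\<bar> \<partial>N)
    \<le> (\<integral>l. \<bar>resp C J p0 1 l - resp C J p b l\<bar> + \<bar>resp C J p0 1 l - resp C J p' b' l\<bar> \<partial>N)"
    using i by (intro integral_mono) auto
  also have "\<dots> = (\<integral>l. \<bar>resp C J p0 1 l - resp C J p b l\<bar> \<partial>N) + (\<integral>l. \<bar>resp C J p0 1 l - resp C J p' b' l\<bar> \<partial>N)"
    using i by (intro Bochner_Integration.integral_add) auto
  finally show ?thesis using b1 b2 by simp
qed

lemma rotated_zero: "j < m \<Longrightarrow> k < m \<Longrightarrow> rotated (unit_vec m) j k 0 = unit_vec m j"
  and rotated_right_angle: "j < m \<Longrightarrow> k < m \<Longrightarrow> rotated (unit_vec m) j k (pi/2) = unit_vec m k"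
  by (auto simp: rotated_def intro!: eq_vecI)

lemma right_outcome:
  assumes "right p (diag_nat m)" "j < m"
  shows "real j \<in> eigvals m (diag_nat m)" "eigproj m (diag_nat m) (real j) = outer (unit_vec m j)"
proof -
  show *: "eigproj m (diag_nat m) (real j) = outer (unit_vec m j)" by (rule eigproj_diag_nat[OF assms(2)])
  have D: "diag_nat m \<in> carrier_mat m m" using self_adjoint_diag_nat by (auto simp: self_adjoint_def)
  have "cinner (unit_vec m j) (unit_vec m j) = 1" using orthonormal_unit_vec assms(2) by (simp add: orthonormal_def)
  then have "tr (outer (unit_vec m j)) \<noteq> tr (0\<^sub>m m m)" by (simp add: tr_outer tr_def[of "0\<^sub>m m m"])
  then show "real j \<in> eigvals m (diag_nat m)" unfolding eigvals_iff[OF D] * by metis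
qed

text \<open>Rotating from \<open>j\<close> to \<open>k\<close> in \<open>L\<close> steps, each of cost \<open>O(1/L^2)\<close>, costs \<open>O(1/L)\<close> in total.\<close>
lemma equal_weights_AE:
  assumes p: "right p (diag_nat m)" and jk: "j < m" "k < m" "c j = c k"
  shows "AE l in N. resp C J p (real j) l = resp C J p (real k) l"
proof (cases "j = k")
  case False
  note jk' = jk(1,2) False jk(3)
  note oj = right_outcome[OF p jk(1)] and ok = right_outcome[OF p jk(2)]
  have pM: "p \<in> Meas C J" using p by (simp add: right_def)
  \<comment> \<open>The last procedure stays arbitrary in the induction, so that the chain can close
    at another outcome of \<open>p\<close> itself.\<close>
  have chain: "(\<integral>l. \<bar>resp C J p (real j) l - resp C J p' b l\<bar> \<partial>N) \<le> real n * (4 * (c k)\<^sup>2 * (sin (\<delta> / 2))\<^sup>2)"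
    if "right p' Y" "b \<in> eigvals m Y" "eigproj m Y b = outer (rotated (unit_vec m) j k (real n * \<delta>))"
    for n p' Y b \<delta>
    using that
  proof (induction n arbitrary: p' Y b)
    case 0
    \<comment> \<open>Even at angle 0 the procedure \<open>p'\<close> may differ from
      \<open>p\<close>; a step with angle difference 0 costs nothing.\<close>
    show ?case using rotated_step[OF jk' p oj(1), of 0 p' Y b 0] 0 oj(2) by (simp add: rotated_zero jk)
  next
    case (Suc n)
    let ?w = "rotated (unit_vec m) j k (real n * \<delta>)"
    have w: "?w \<in> carrier_vec m" "cinner ?w ?w = 1"
      using rotated_carrier[OF orthonormal_unit_vec jk(1,2)] cinner_rotated_self[OF orthonormal_unit_vec jk(1,2) False]
      by auto
    note ev = eigvals_outer[OF w]
    obtain p0 where p0: "right p0 (outer ?w)" using ex_right[OF self_adjoint_outer[OF w(1)]] by blast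
    have i: "integrable N (resp C J p (real j))" "integrable N (resp C J p0 1)" "integrable N (resp C J p' b)"
      using pM p0 Suc.prems integrable_resp by (auto simp: right_def)
    have "(\<integral>l. \<bar>resp C J p (real j) l - resp C J p' b l\<bar> \<partial>N)
      \<le> (\<integral>l. \<bar>resp C J p (real j) l - resp C J p0 1 l\<bar> + \<bar>resp C J p0 1 l - resp C J p' b l\<bar> \<partial>N)"
      using i by (intro integral_mono) auto
    also have "\<dots> = (\<integral>l. \<bar>resp C J p (real j) l - resp C J p0 1 l\<bar> \<partial>N) + (\<integral>l. \<bar>resp C J p0 1 l - resp C J p' b l\<bar> \<partial>N)"
      using i by (intro Bochner_Integration.integral_add) auto
    also have "\<dots> \<le> real n * (4 * (c k)\<^sup>2 * (sin (\<delta> / 2))\<^sup>2) + 4 * (c k)\<^sup>2 * (sin (\<delta> / 2))\<^sup>2"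
    proof (rule add_mono)
      show "(\<integral>l. \<bar>resp C J p (real j) l - resp C J p0 1 l\<bar> \<partial>N) \<le> real n * (4 * (c k)\<^sup>2 * (sin (\<delta> / 2))\<^sup>2)"
        by (rule Suc.IH[OF p0 ev(2,1)])
      have "(real n * \<delta> - real (Suc n) * \<delta>) / 2 = - (\<delta> / 2)" by (simp add: field_simps)
      then show "(\<integral>l. \<bar>resp C J p0 1 l - resp C J p' b l\<bar> \<partial>N) \<le> 4 * (c k)\<^sup>2 * (sin (\<delta> / 2))\<^sup>2"
        using rotated_step[OF jk' p0 ev(2,1) Suc.prems] by simp
    qed
    finally show ?case by (simp add: algebra_simps)
  qed
  let ?D = "\<integral>l. \<bar>resp C J p (real j) l - resp C J p (real k) l\<bar> \<partial>N"
  \<comment> \<open>With \<open>L = n + 1\<close> steps of angle \<open>pi / (2 * L)\<close>, the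
    total is at most \<open>L * 4 * (c k)\<^sup>2 * (pi / (4 * L))\<^sup>2\<close>.\<close>
  have bound: "?D \<le> (c k)\<^sup>2 * pi\<^sup>2 / 4 * inverse (real (Suc n))" for n
  proof -
    define L where "L = real (Suc n)"
    have L: "L > 0" by (simp add: L_def)
    have "L * (pi / 2 / L) = pi / 2" using L by simp
    then have "real (Suc n) * (pi / 2 / real (Suc n)) = pi / 2" by (simp only: L_def)
    then have "?D \<le> L * (4 * (c k)\<^sup>2 * (sin (pi / 2 / L / 2))\<^sup>2)"
      unfolding L_def
      by (intro chain[OF p ok(1), of "Suc n" "pi / 2 / real (Suc n)"])
        (simp only: ok(2) rotated_right_angle[OF jk(1,2)])
    also have "(sin (pi / 2 / L / 2))\<^sup>2 \<le> (pi / 2 / L / 2)\<^sup>2"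
      using abs_sin_x_le_abs_x[of "pi / 2 / L / 2"] by (simp only: abs_le_square_iff)
    then have "L * (4 * (c k)\<^sup>2 * (sin (pi / 2 / L / 2))\<^sup>2) \<le> L * (4 * (c k)\<^sup>2 * (pi / 2 / L / 2)\<^sup>2)"
      using L by (intro mult_left_mono) auto
    also have "\<dots> = (c k)\<^sup>2 * pi\<^sup>2 / 4 * inverse L"
      using L by (simp add: field_simps power2_eq_square)
    finally show ?thesis by (simp add: L_def)
  qed
  have "(\<lambda>n. (c k)\<^sup>2 * pi\<^sup>2 / 4 * inverse (real (Suc n))) \<longlonglongrightarrow> (c k)\<^sup>2 * pi\<^sup>2 / 4 * 0"
    by (intro tendsto_mult tendsto_const LIMSEQ_inverse_real_of_nat)
  then have "?D \<le> (c k)\<^sup>2 * pi\<^sup>2 / 4 * 0"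
    by (rule LIMSEQ_le_const) (use bound in blast)
  then have "?D = 0" by (intro antisym) auto
  moreover have "integrable N (\<lambda>l. \<bar>resp C J p (real j) l - resp C J p (real k) l\<bar>)"
    using integrable_resp[OF pM] by simp
  ultimately have "AE l in N. \<bar>resp C J p (real j) l - resp C J p (real k) l\<bar> = 0"
    by (subst (asm) integral_nonneg_eq_0_iff_AE) auto
  then show ?thesis by eventually_elim simp
qed simp

text \<open>Equal weights give equal responses; the weights outside \<open>G\<close> are treated as error.\<close>
lemma schmidt_deviation_le:
  assumes p: "left p A" and a: "a \<in> eigvals d A"
    and norm: "(\<Sum>j<m. (c j)\<^sup>2) = 1"
    and S: "S \<subseteq> {..<m}" and G: "G \<subseteq> {..<m}"
    and E: "\<And>j. j < m \<Longrightarrow> eigproj d A a *\<^sub>v e j = (if j \<in> S then e j else 0\<^sub>v d)"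
    and cG: "\<And>j k. j \<in> G \<Longrightarrow> k \<in> G \<Longrightarrow> c j = c k"
  shows "(\<integral>l. \<bar>resp C J p a l - (\<Sum>j\<in>S. (c j)\<^sup>2)\<bar> \<partial>N) \<le> 2 * (\<Sum>j\<in>{..<m} - G. (c j)\<^sup>2)"
proof -
  obtain p' where p': "right p' (diag_nat m)" using ex_right[OF self_adjoint_diag_nat] by blast
  have pM: "p \<in> Meas C J" "p' \<in> Meas C J" using p p' by (auto simp: left_def right_def)
  define y where "y j = resp C J p' (real j)" for j :: nat
  have iy: "integrable N (y j)" for j using integrable_resp[OF pM(2)] by (simp add: y_def)
  have finS: "finite S" using S finite_subset by blast
  note out = right_outcome[OF p']
  have ec: "e j \<in> carrier_vec d" "cinner (e j) (e j) = 1" if "j < m" for j using e that by (auto simp: orthonormal_def)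
  have ce: "cinner (e j) (eigproj d A a *\<^sub>v e j) = (if j \<in> S then 1 else 0)" if "j < m" for j
    using ec[OF that] E[OF that] by (simp add: cinner_zero)
  have D: "diag_nat m \<in> carrier_mat m m" using self_adjoint_diag_nat by (auto simp: self_adjoint_def)
  have inty: "(\<integral>l. y j l \<partial>N) = (c j)\<^sup>2" if "j < m" for j
  proof -
    have ev: "eigvals (sdim C J) (obs C J p') = eigvals m (diag_nat m)"
      "eigproj (sdim C J) (obs C J p') (real j) = kron (1\<^sub>m d) (kron (outer (unit_vec m j)) (1\<^sub>m d))"
      using p' out[OF that] eigvals_one_kron[OF kron_carrier[OF D one_carrier_mat] sdim_pos]
        eigvals_kron_one[OF D sdim_pos] eigproj_one_kron[OF kron_carrier[OF D one_carrier_mat]] eigproj_kron_one[OF D]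
      by (auto simp: right_def sdim_joint sdim_s')
    have "complex_of_real (\<integral>l. y j l \<partial>N) = schmidt_corr m c e (1\<^sub>m d) (outer (unit_vec m j))"
      using reproducesD(1)[OF rep pM(2), of "real j"] out[OF that] corr[OF one_carrier_mat outer_carrier[of "unit_vec m j" m]]
      by (simp add: ev y_def)
    also have "\<dots> = complex_of_real ((c j)\<^sup>2)"
      using ec[OF that] by (simp add: schmidt_corr_unit[OF that])
    finally show ?thesis by (simp only: of_real_eq_iff)
  qed
  have AE_zero: "AE l in N. f l = 0" if "integrable N f" "(\<integral>l. f l \<partial>N) \<le> 0" "\<And>l. l \<in> space N \<Longrightarrow> 0 \<le> f l" for f :: "'l \<Rightarrow> real"
  proof -
    have "AE l in N. 0 \<le> f l" using that(3) by (rule AE_I2)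
    moreover from this have "(\<integral>l. f l \<partial>N) = 0" using that(2) integral_nonneg_AE by (intro antisym) blast+
    ultimately show ?thesis using integral_nonneg_eq_0_iff_AE[OF that(1)] by simp
  qed
  have ybd: "0 \<le> y j l" "(\<Sum>j<m. y j l) \<le> 1" if "l \<in> space N" for j l
    using resp_bounds(1)[OF pM(2)] resp_sum_le_one[OF pM(2), of l "real ` {..<m}"] that
    by (auto simp: y_def space_N sum.reindex inj_on_def)
  \<comment> \<open>Pointwise only \<open>\<le> 1\<close> is available; the weights sum to 1, hence
    so does the mean, and equality holds almost surely.\<close>
  have "AE l in N. 1 - (\<Sum>j<m. y j l) = 0"
    by (rule AE_zero) (use iy ybd inty norm in \<open>auto simp: prob_space\<close>)
  \<comment> \<open>Perfect correlation: each \<open>e j\<close> is fixed or annihilated by the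
    eigenprojection, so the bound of \<open>deviation_le\<close> is \<open>q + q - 2 * q\<close>,
    with \<open>q\<close> the sum of the weights in \<open>S\<close>.\<close>
  moreover have "AE l in N. \<bar>resp C J p a l - (\<Sum>j\<in>S. y j l)\<bar> = 0"
  proof (rule AE_zero)
    have "(\<Sum>b\<in>real ` S. f b) = (\<Sum>j\<in>S. f (real j))" for f :: "real \<Rightarrow> real" by (simp add: sum.reindex inj_on_def)
    note re = this
    have "(\<Sum>j<m. if j \<in> S then (c j)\<^sup>2 else 0) = (\<Sum>j\<in>S. (c j)\<^sup>2)"
      using S by (simp add: sum.If_cases Int_absorb1)
    then have r1: "Re (schmidt_corr m c e (eigproj d A a) (1\<^sub>m m)) = (\<Sum>j\<in>S. (c j)\<^sup>2)"
      by (simp add: schmidt_corr_one_right ce if_distrib[of Re] if_distrib[of "\<lambda>z. _ * z"] flip: of_real_power cong: if_cong)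
    have r2: "Re (schmidt_corr m c e (1\<^sub>m d) (outer (unit_vec m j))) = (c j)\<^sup>2"
      "Re (schmidt_corr m c e (eigproj d A a) (outer (unit_vec m j))) = (c j)\<^sup>2" if "j \<in> S" for j
      using that S ec ce by (auto simp: schmidt_corr_unit subset_iff simp flip: of_real_power)
    have "real ` S \<subseteq> eigvals m (diag_nat m)" using out S by auto
    then show "(\<integral>l. \<bar>resp C J p a l - (\<Sum>j\<in>S. y j l)\<bar> \<partial>N) \<le> 0"
      using deviation_le[OF p p' a, of "real ` S"] S
      by (simp add: re y_def r1 out(2) subset_iff r2 cong: sum.cong)
    show "integrable N (\<lambda>l. \<bar>resp C J p a l - (\<Sum>j\<in>S. y j l)\<bar>)" using integrable_resp[OF pM(1)] iy by simp
  qed simp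
  moreover have "AE l in N. \<forall>j\<in>G. \<forall>k\<in>G. y j l = y k l"
  proof (intro eventually_ball_finite ballI)
    fix j k assume "j \<in> G" "k \<in> G"
    then show "AE l in N. y j l = y k l"
      unfolding y_def using G by (intro equal_weights_AE[OF p'] cG) auto
  qed (rule finite_subset[OF G finite_lessThan])+
  ultimately have AE: "AE l in N. \<bar>resp C J p a l - (\<Sum>j\<in>S. (c j)\<^sup>2)\<bar>
      \<le> (\<Sum>j\<in>{..<m} - G. y j l) + (\<Sum>j\<in>{..<m} - G. (c j)\<^sup>2)"
    using AE_space
  proof eventually_elim
    case (elim l)
    \<comment> \<open>Almost surely the responses \<open>y j l\<close> share with the weights
      \<open>(c j)\<^sup>2\<close> both the total 1 and constancy on \<open>G\<close>.\<close>
    have "\<bar>(\<Sum>j\<in>S. y j l) - (\<Sum>j\<in>S. (c j)\<^sup>2)\<bar> \<le> (\<Sum>j\<in>{..<m} - G. y j l) + (\<Sum>j\<in>{..<m} - G. (c j)\<^sup>2)"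
    proof (rule subset_sum_gap[OF finite_lessThan S G])
      show "(\<Sum>j<m. y j l) = 1" using elim by simp
      show "y j l = y k l" if "j \<in> G" "k \<in> G" for j k using elim that by blast
      show "(c j)\<^sup>2 = (c k)\<^sup>2" if "j \<in> G" "k \<in> G" for j k using cG[OF that] by simp
    qed (use norm ybd elim(4) in auto)
    then show ?case using elim by simp
  qed
  have "(\<integral>l. \<bar>resp C J p a l - (\<Sum>j\<in>S. (c j)\<^sup>2)\<bar> \<partial>N)
      \<le> (\<integral>l. (\<Sum>j\<in>{..<m} - G. y j l) + (\<Sum>j\<in>{..<m} - G. (c j)\<^sup>2) \<partial>N)"
    using integrable_resp[OF pM(1)] iy AE by (intro integral_mono_AE) auto
  \<comment> \<open>Each \<open>y j\<close> has mean \<open>(c j)\<^sup>2\<close>, so the two tails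
    contribute equally.\<close>
  also have "\<dots> = 2 * (\<Sum>j\<in>{..<m} - G. (c j)\<^sup>2)"
    using iy inty by (simp add: prob_space)
  finally show ?thesis .
qed

end

subsection \<open>Reduction to Schmidt states\<close>

context complete_model
begin

text \<open>The deviation is carried through the ancilla and the swap to a
  \<open>schmidt_model\<close>. Orthonormality forces \<open>m \<le> sdim C s\<close>, so the
  weights cannot yet be made small at will.\<close>

lemma deviation_le_tail:
  fixes s :: 's
  assumes anc: "ancilla_independence C" and ui: "unitary_invariance C" and pind: "parameter_independence C"
    and P: "P \<in> Prep C s" and p: "p \<in> Meas C s" and a: "a \<in> eigvals (sdim C s) (obs C s p)"
    and e: "orthonormal (sdim C s) m e" and norm: "(\<Sum>j<m. (c j)\<^sup>2) = 1"
    and S: "S \<subseteq> {..<m}" and G: "G \<subseteq> {..<m}"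
    and E: "\<And>j. j < m \<Longrightarrow> eigproj (sdim C s) (obs C s p) a *\<^sub>v e j = (if j \<in> S then e j else 0\<^sub>v (sdim C s))"
    and cG: "\<And>j k. j \<in> G \<Longrightarrow> k \<in> G \<Longrightarrow> c j = c k"
    and q: "tr (rho C s P * eigproj (sdim C s) (obs C s p) a) = complex_of_real (\<Sum>j\<in>S. (c j)\<^sup>2)"
  shows "(\<integral>l. \<bar>resp C s p a l - (\<Sum>j\<in>S. (c j)\<^sup>2)\<bar> \<partial>mu C s P) \<le> 2 * (\<Sum>j\<in>{..<m} - G. (c j)\<^sup>2)"
proof -
  define d where "d = sdim C s"
  define A where "A = obs C s p"
  define \<phi> where "\<phi> = schmidt_vec d m c e"
  let ?q = "\<Sum>j\<in>S. (c j)\<^sup>2"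
  have d: "d \<ge> 1" using sdim_pos by (simp add: d_def)
  have m: "m \<ge> 1" using norm by (cases m) auto
  have "m * d \<ge> 1" using d m by simp
  \<comment> \<open>Only the dimension matters: \<open>s'\<close> need not be a joint system, as the
    factorization into \<open>C^m\<close> and a copy of \<open>H\<close> is made at the level of
    matrices.\<close>
  then obtain s' where s': "sdim C s' = m * d" using system_of_dim by blast
  have \<phi>: "\<phi> \<in> carrier_vec (m*d)" by (simp add: \<phi>_def schmidt_vec_carrier)
  have ec: "\<And>j. j < m \<Longrightarrow> e j \<in> carrier_vec d" using e by (auto simp: orthonormal_def d_def)
  have A: "A \<in> carrier_mat d d" and As: "self_adjoint d A"
    using obs_self_adjoint[OF p] by (auto simp: self_adjoint_def A_def d_def)
  have Ec: "eigproj d A a \<in> carrier_mat d d" by (rule eigproj_carrier[OF A])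
  have R: "rho C s P \<in> carrier_mat d d" and trR: "tr (rho C s P) = 1"
    using rho_density[OF P] by (auto simp: density_def self_adjoint_def d_def)
  have sc: "cinner \<phi> (kron Y X *\<^sub>v \<phi>) = schmidt_corr m c e X Y"
    if "X \<in> carrier_mat d d" "Y \<in> carrier_mat m m" for X Y
    unfolding \<phi>_def schmidt_corr_def by (rule cinner_schmidt_vec[OF that ec])
  have "cinner \<phi> (kron (1\<^sub>m m) (1\<^sub>m d) *\<^sub>v \<phi>) = complex_of_real (\<Sum>j<m. (c j)\<^sup>2)"
    using schmidt_corr_one_left[OF e, of c "1\<^sub>m m"] sc[of "1\<^sub>m d" "1\<^sub>m m"] by (simp add: d_def)
  then have \<phi>1: "cinner \<phi> \<phi> = 1" using \<phi> norm by (simp add: kron_one)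
  obtain P2 where P2: "P2 \<in> Prep C s'" "rho C s' P2 = outer \<phi>"
    using ex_Prep[of s' "outer \<phi>"] density_outer[OF \<phi> \<phi>1] s' by auto
  let ?J = "joint C s s'"
  have dJ: "sdim C ?J = d * (m * d)" by (simp add: sdim_joint s' d_def)
  obtain p' P' where p': "p' \<in> Meas C ?J" "obs C ?J p' = kron A (1\<^sub>m (m*d))"
    and P': "P' \<in> Prep C ?J" "rho C ?J P' = kron (rho C s P) (outer \<phi>)"
    and le1: "(\<integral>l. \<bar>resp C s p a l - ?q\<bar> \<partial>mu C s P) \<le> (\<integral>l. \<bar>resp C ?J p' a l - ?q\<bar> \<partial>mu C ?J P')"
    using ancilla_transfer[OF anc P P2(1) p] a by (metis A_def P2(2) s')
  obtain T where T: "T \<in> Trans C ?J" "uni C ?J T = swap_mat d m"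
    using ex_Trans[of ?J "swap_mat d m"] unitary_swap_mat[of d m] dJ by auto
  define \<sigma> where "\<sigma> = swap_mat d m * kron (rho C s P) (outer \<phi>) * adj (swap_mat d m)"
  have corr: "tr (\<sigma> * kron X (kron Y (1\<^sub>m d))) = schmidt_corr m c e X Y"
    if "X \<in> carrier_mat d d" "Y \<in> carrier_mat m m" for X Y
    unfolding \<sigma>_def tr_swapped_state[OF that R \<phi>] by (simp add: trR sc[OF that])
  define N where "N = mu C ?J P' \<bind> gam C ?J T"
  have rep: "reproduces s s' N \<sigma>"
    using reproduces_evolved[OF P'(1) T(1)] by (simp add: T(2) P'(2) N_def \<sigma>_def)
  interpret S: schmidt_model C s s' N \<sigma> m c e
    by unfold_locales (use pind s' rep e corr in \<open>auto simp: d_def\<close>)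
  have left: "S.left p' A" using p' As by (simp add: S.left_def d_def)
  have aA: "a \<in> eigvals d A" using a by (simp add: A_def d_def)
  have EJ: "eigproj (sdim C ?J) (obs C ?J p') a = kron (eigproj d A a) (1\<^sub>m (m*d))"
    using eigproj_kron_one[OF A] by (simp add: p'(2) dJ)
  have aJ: "a \<in> eigvals (sdim C ?J) (obs C ?J p')"
    using eigvals_kron_one[OF A \<open>m * d \<ge> 1\<close>] aA by (simp add: p'(2) dJ)
  \<comment> \<open>Before the swap the probability is \<open>?q\<close> by the state of
    \<open>H\<close>, after it (\<open>tr2\<close>) by the weights in \<open>S\<close>; this
    equality is the premise of unitary invariance.\<close>
  have tr1: "tr (rho C ?J P' * eigproj (sdim C ?J) (obs C ?J p') a) = complex_of_real ?q"
    using kron_mult[OF R outer_carrier[OF \<phi>] Ec one_carrier_mat] tr_kron[OF mult_carrier_mat[OF R Ec] outer_carrier[OF \<phi>]]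
      q outer_carrier[OF \<phi>]
    by (simp add: P'(2) EJ tr_outer \<phi>1 A_def d_def)
  have ce: "cinner (e j) (eigproj d A a *\<^sub>v e j) = (if j \<in> S then 1 else 0)" if "j < m" for j
    using that E[OF that] e ec[OF that] by (simp add: A_def d_def orthonormal_def cinner_zero)
  have "schmidt_corr m c e (eigproj d A a) (1\<^sub>m m) = complex_of_real (\<Sum>j<m. if j \<in> S then (c j)\<^sup>2 else 0)"
    unfolding schmidt_corr_one_right of_real_sum by (rule sum.cong) (simp_all add: ce)
  also have "(\<Sum>j<m. if j \<in> S then (c j)\<^sup>2 else 0) = ?q"
    using S by (simp add: sum.If_cases Int_absorb1)
  finally have "tr (\<sigma> * kron (eigproj d A a) (1\<^sub>m (m*d))) = complex_of_real ?q"
    using corr[OF Ec one_carrier_mat] by (simp add: kron_one)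
  then have tr2: "tr (uni C ?J T * rho C ?J P' * adj (uni C ?J T) * eigproj (sdim C ?J) (obs C ?J p') a) = complex_of_real ?q"
    by (simp add: \<sigma>_def T(2) P'(2) EJ)
  have ae: "AE l in mu C ?J P'. resp C ?J p' a l = (\<integral>l'. resp C ?J p' a l' \<partial>gam C ?J T l)"
    by (rule ui[unfolded unitary_invariance_def Let_def, rule_format, OF P'(1) T(1) p'(1) aJ])
      (simp only: tr1 tr2)
  have "(\<integral>l. \<bar>resp C ?J p' a l - ?q\<bar> \<partial>mu C ?J P') \<le> (\<integral>l. \<bar>resp C ?J p' a l - ?q\<bar> \<partial>N)"
    unfolding N_def
    by (rule mean_deviation_bind_le[OF mu_prob[OF P'(1)] gam_kernel[OF T(1)] resp_measurable[OF p'(1)] _ ae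
          resp_measurable[OF p'(1)]]) (use resp_bounds[OF p'(1)] in auto)
  also have "\<dots> \<le> 2 * (\<Sum>j\<in>{..<m} - G. (c j)\<^sup>2)"
    by (rule S.schmidt_deviation_le[OF left _ norm S G _ cG]) (use aA E in \<open>auto simp: A_def d_def\<close>)
  finally show ?thesis using le1 by linarith
qed

end

text \<open>The vector \<open>u (x) delta_j\<close> in \<open>C^n (x) C^m\<close>. Different labels
  \<open>j\<close> give orthogonal vectors whatever the first factors are.\<close>

definition tensor_unit :: "nat \<Rightarrow> complex vec \<Rightarrow> nat \<Rightarrow> complex vec" where
  "tensor_unit m u j = vec (dim_vec u * m) (\<lambda>i. if i mod m = j then u $ (i div m) else 0)"

lemma tensor_unit_carrier: "u \<in> carrier_vec n \<Longrightarrow> tensor_unit m u j \<in> carrier_vec (n*m)"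
  by (auto simp: tensor_unit_def)

lemma tensor_unit_index:
  "u \<in> carrier_vec n \<Longrightarrow> i < n \<Longrightarrow> k < m \<Longrightarrow> tensor_unit m u j $ (i*m+k) = (if k = j then u $ i else 0)"
  using block_lt[of i n k m] by (auto simp: tensor_unit_def)

lemma cinner_tensor_unit:
  assumes u: "u \<in> carrier_vec n" and w: "w \<in> carrier_vec n" and jk: "j < m" "k < m"
  shows "cinner (tensor_unit m u j) (tensor_unit m w k) = (if j = k then cinner u w else 0)"
proof -
  have "cinner (tensor_unit m u j) (tensor_unit m w k)
     = (\<Sum>i<n*m. (if i mod m = j then cnj (u $ (i div m)) else 0) * (if i mod m = k then w $ (i div m) else 0))"
    unfolding cinner_sum[OF tensor_unit_carrier[OF u]]
    by (rule sum.cong) (use u w in \<open>auto simp: tensor_unit_def\<close>)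
  also have "\<dots> = (\<Sum>i<n. \<Sum>l<m. (if l = j then cnj (u $ i) else 0) * (if l = k then w $ i else 0))"
    by (rule sum_div_mod)
  also have "\<dots> = (\<Sum>i<n. if j = k then cnj (u $ i) * w $ i else 0)"
    using jk by (intro sum.cong refl) (simp add: if_distrib[of "\<lambda>z. z * _"] cong: if_cong)
  finally show ?thesis using u by (simp add: cinner_sum)
qed

lemma kron_one_tensor_unit:
  assumes X: "X \<in> carrier_mat n n" and u: "u \<in> carrier_vec n"
  shows "kron X (1\<^sub>m m) *\<^sub>v tensor_unit m u j = tensor_unit m (X *\<^sub>v u) j"
proof (rule eq_vec_block[of _ n m])
  have Xu: "X *\<^sub>v u \<in> carrier_vec n" using X u by auto
  show "kron X (1\<^sub>m m) *\<^sub>v tensor_unit m u j \<in> carrier_vec (n*m)"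
    by (rule mult_mat_vec_carrier[OF kron_carrier[OF X one_carrier_mat] tensor_unit_carrier[OF u]])
  show "tensor_unit m (X *\<^sub>v u) j \<in> carrier_vec (n*m)" by (rule tensor_unit_carrier[OF Xu])
  fix i k assume ik: "i < n" "k < m"
  have "vec n (\<lambda>i. tensor_unit m u j $ (i*m+k)) = (if k = j then u else 0\<^sub>v n)"
    using u ik by (auto simp: tensor_unit_index[OF u] intro!: eq_vecI)
  then show "(kron X (1\<^sub>m m) *\<^sub>v tensor_unit m u j) $ (i*m+k) = tensor_unit m (X *\<^sub>v u) j $ (i*m+k)"
    using ik by (simp add: kron_one_vec_entry[OF X tensor_unit_carrier[OF u] ik] tensor_unit_index[OF Xu ik] mult_zero_vec[OF X])
qed

context complete_model
begin

text \<open>Tensoring with \<open>C^m\<close> yields \<open>m\<close> orthonormal vectors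
  \<open>v (x) delta_j\<close> or \<open>w (x) delta_j\<close>, each fixed or annihilated by the
  enlarged eigenprojection. So \<open>m\<close>, and with it \<open>L\<close>, is not limited by the
  dimension of \<open>H\<close>.\<close>

lemma deviation_le_inverse:
  fixes s :: 's
  assumes anc: "ancilla_independence C" and ui: "unitary_invariance C" and pind: "parameter_independence C"
    and P: "P \<in> Prep C s" and p: "p \<in> Meas C s" and a: "a \<in> eigvals (sdim C s) (obs C s p)"
    and q: "tr (rho C s P * eigproj (sdim C s) (obs C s p) a) = complex_of_real q" "0 \<le> q" "q \<le> 1"
    and v: "v \<in> carrier_vec (sdim C s)" "cinner v v = 1" "eigproj (sdim C s) (obs C s p) a *\<^sub>v v = v"
    and w: "w \<in> carrier_vec (sdim C s)" "cinner w w = 1" "eigproj (sdim C s) (obs C s p) a *\<^sub>v w = 0\<^sub>v (sdim C s)"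
    and L: "L \<ge> 1"
  shows "(\<integral>l. \<bar>resp C s p a l - q\<bar> \<partial>mu C s P) \<le> 4 / real L"
proof -
  define n where "n = sdim C s"
  define A where "A = obs C s p"
  \<comment> \<open>Split \<open>q\<close> and \<open>1 - q\<close> into parts \<open>1 / L\<close>, with one remainder each (indices \<open>g\<close> and \<open>g + 1\<close>).\<close>
  define k where "k = nat \<lfloor>q * real L\<rfloor>"
  define k' where "k' = nat \<lfloor>(1 - q) * real L\<rfloor>"
  define g where "g = k + k'"
  define m where "m = g + 2"
  have kL: "real k \<le> q * L" "q * L < real k + 1" "real k' \<le> (1 - q) * L" "(1 - q) * L < real k' + 1"
    using q L unfolding k_def k'_def by (auto simp: of_nat_floor)
  have L0: "real L > 0" using L by simp
  \<comment> \<open>The radicands at \<open>g\<close> and \<open>g + 1\<close> are nonnegative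
    because \<open>k\<close> and \<open>k'\<close> are floors.\<close>
  define c where "c j = (if j < g then sqrt (1 / L) else if j = g then sqrt (q - k / L) else sqrt (1 - q - k' / L))" for j
  \<comment> \<open>The first \<open>k\<close> parts and the remainder at \<open>g\<close> make up
    \<open>q\<close>; the other indices below \<open>m\<close> make up \<open>1 - q\<close>.\<close>
  define S where "S = {..<k} \<union> {g}"
  have c2: "(c j)\<^sup>2 = (if j < g then 1 / L else if j = g then q - k / L else 1 - q - k' / L)" for j
    using kL L0 by (auto simp: c_def field_simps)
  have sumS: "(\<Sum>j\<in>S. (c j)\<^sup>2) = q"
  proof -
    have "(\<Sum>j\<in>S. (c j)\<^sup>2) = (\<Sum>j<k. (c j)\<^sup>2) + (c g)\<^sup>2"
      unfolding S_def by (subst sum.union_disjoint) (auto simp: g_def)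
    also have "(\<Sum>j<k. (c j)\<^sup>2) = (\<Sum>j<k. 1 / L)" by (rule sum.cong) (auto simp: c2 g_def)
    finally show ?thesis by (simp add: c2)
  qed
  have sumg: "(\<Sum>j<g. (c j)\<^sup>2) = g / L" by (simp add: c2)
  have norm: "(\<Sum>j<m. (c j)\<^sup>2) = 1"
    using sumg by (simp add: m_def c2 g_def add_divide_distrib)
  have "(\<Sum>j\<in>{..<m} - {..<g}. (c j)\<^sup>2) = (\<Sum>j<m. (c j)\<^sup>2) - (\<Sum>j<g. (c j)\<^sup>2)"
    by (rule sum_diff) (auto simp: m_def)
  then have "(\<Sum>j\<in>{..<m} - {..<g}. (c j)\<^sup>2) = 1 - g / L" using norm sumg by simp
  also have "\<dots> \<le> 2 / L"
  proof -
    \<comment> \<open>Adding \<open>q * L < k + 1\<close> and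
      \<open>(1 - q) * L < k' + 1\<close>.\<close>
    have "real L \<le> g + 2" using kL unfolding g_def by (simp add: algebra_simps)
    then have "(real L - g) / L \<le> 2 / L" by (intro divide_right_mono) auto
    then show ?thesis using L0 by (simp add: diff_divide_distrib)
  qed
  finally have tail: "(\<Sum>j\<in>{..<m} - {..<g}. (c j)\<^sup>2) \<le> 2 / L" .
  have "m \<ge> 1" by (simp add: m_def)
  then obtain s' where s': "sdim C s' = m" using system_of_dim by blast
  \<comment> \<open>Any state of the auxiliary factor would serve, since the measurement acts on the
    other one; index 0 exists because \<open>m \<ge> 2\<close>.\<close>
  have u0: "cinner (unit_vec m 0) (unit_vec m 0) = 1"
    using orthonormal_unit_vec[of m] by (simp add: orthonormal_def m_def)
  obtain P2 where P2: "P2 \<in> Prep C s'" "rho C s' P2 = outer (unit_vec m 0)"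
    using ex_Prep[of s' "outer (unit_vec m 0)"] density_outer[OF _ u0] s' by auto
  let ?J = "joint C s s'"
  have dJ: "sdim C ?J = n * m" by (simp add: sdim_joint s' n_def)
  obtain p' P' where p': "p' \<in> Meas C ?J" "obs C ?J p' = kron A (1\<^sub>m m)"
    and P': "P' \<in> Prep C ?J" "rho C ?J P' = kron (rho C s P) (outer (unit_vec m 0))"
    and le1: "(\<integral>l. \<bar>resp C s p a l - q\<bar> \<partial>mu C s P) \<le> (\<integral>l. \<bar>resp C ?J p' a l - q\<bar> \<partial>mu C ?J P')"
    using ancilla_transfer[OF anc P P2(1) p] a by (metis A_def P2(2) s')
  have A: "A \<in> carrier_mat n n"
    using obs_self_adjoint[OF p] by (auto simp: self_adjoint_def A_def n_def)
  note Ec = eigproj_carrier[OF A, of a]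
  have R: "rho C s P \<in> carrier_mat n n"
    using rho_density[OF P] by (auto simp: density_def self_adjoint_def n_def)
  have o: "outer (unit_vec m 0) \<in> carrier_mat m m" by simp
  have EJ: "eigproj (sdim C ?J) (obs C ?J p') a = kron (eigproj n A a) (1\<^sub>m m)"
    using eigproj_kron_one[OF A] by (simp add: p'(2) dJ)
  have aJ: "a \<in> eigvals (sdim C ?J) (obs C ?J p')"
    using eigvals_kron_one[OF A \<open>m \<ge> 1\<close>] a by (simp add: p'(2) dJ A_def n_def)
  have trJ: "tr (rho C ?J P' * eigproj (sdim C ?J) (obs C ?J p') a) = complex_of_real (\<Sum>j\<in>S. (c j)\<^sup>2)"
    using kron_mult[OF R o Ec one_carrier_mat] tr_kron[OF mult_carrier_mat[OF R Ec] o] q(1) o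
    by (simp add: P'(2) EJ tr_outer u0 A_def n_def sumS)
  define e where "e j = tensor_unit m (if j \<in> S then v else w) j" for j
  have vw: "v \<in> carrier_vec n" "w \<in> carrier_vec n" "eigproj n A a *\<^sub>v v = v" "eigproj n A a *\<^sub>v w = 0\<^sub>v n"
    using v w by (auto simp: n_def A_def)
  have on: "orthonormal (sdim C ?J) m e"
    unfolding orthonormal_def dJ
    using vw v(2) w(2) by (auto simp: e_def cinner_tensor_unit[of _ n] intro!: tensor_unit_carrier)
  have z: "tensor_unit m (0\<^sub>v n) j = 0\<^sub>v (n*m)" for j
    by (rule eq_vecI) (auto simp: tensor_unit_def div_mod_lt)
  have "(\<integral>l. \<bar>resp C ?J p' a l - (\<Sum>j\<in>S. (c j)\<^sup>2)\<bar> \<partial>mu C ?J P') \<le> 2 * (\<Sum>j\<in>{..<m} - {..<g}. (c j)\<^sup>2)"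
  proof (rule deviation_le_tail[OF anc ui pind P'(1) p'(1) aJ on norm _ _ _ _ trJ])
    show "S \<subseteq> {..<m}" by (auto simp: S_def m_def g_def)
    show "{..<g} \<subseteq> {..<m}" by (auto simp: m_def)
    show "c j = c l" if "j \<in> {..<g}" "l \<in> {..<g}" for j l using that by (simp add: c_def)
    show "eigproj (sdim C ?J) (obs C ?J p') a *\<^sub>v e j = (if j \<in> S then e j else 0\<^sub>v (sdim C ?J))" for j
      unfolding EJ unfolding dJ using vw by (simp add: e_def kron_one_tensor_unit[OF Ec] z)
  qed
  then show ?thesis using le1 tail sumS by simp
qed

lemma psi_complete:
  assumes anc: "ancilla_independence C" and ui: "unitary_invariance C" and pind: "parameter_independence C"
  shows "psi_complete C s"
  unfolding psi_complete_def Let_def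
proof (intro ballI)
  fix P p a
  assume P: "P \<in> Prep C s" and p: "p \<in> Meas C s" and a: "a \<in> eigvals (sdim C s) (obs C s p)"
  define n where "n = sdim C s"
  define E where "E = eigproj (sdim C s) (obs C s p) a"
  define q where "q = (\<integral>l. resp C s p a l \<partial>mu C s P)"
  have q: "tr (rho C s P * E) = complex_of_real q"
    using system(2)[of s] P p a by (simp add: ontic_model_def Let_def q_def E_def)
  have M: "prob_space (mu C s P)" "sets (mu C s P) = sets (Lam C s)" "space (mu C s P) = space (Lam C s)"
    using mu_prob[OF P] sets_eq_imp_space_eq by (auto simp: space_prob_algebra)
  interpret prob_space "mu C s P" by (rule M)
  have bd: "0 \<le> resp C s p a l" "resp C s p a l \<le> 1" if "l \<in> space (mu C s P)" for l
    using resp_bounds[OF p] that M by auto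
  have int: "integrable (mu C s P) (resp C s p a)"
    by (rule integrable_const_bound[of _ 1])
      (use bd resp_measurable[OF p] M in \<open>auto cong: measurable_cong_sets\<close>)
  have q01: "0 \<le> q" "q \<le> 1"
    unfolding q_def using bd int by (auto intro!: integral_ge_const integral_le_const)
  have A: "obs C s p \<in> carrier_mat n n"
    using obs_self_adjoint[OF p] by (auto simp: self_adjoint_def n_def)
  have Ec: "E \<in> carrier_mat n n" "E * E = E"
    using eigproj_carrier[OF A] eigproj_idem[OF A] by (auto simp: E_def n_def)
  have rho: "rho C s P \<in> carrier_mat n n" "tr (rho C s P) = 1"
    using rho_density[OF P] by (auto simp: density_def self_adjoint_def n_def)
  have "(\<integral>l. \<bar>resp C s p a l - q\<bar> \<partial>mu C s P) = 0"
  \<comment> \<open>For \<open>q = 1\<close> the eigenprojection may be the identity and annihilate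
    no unit vector; but a response of at most 1 with mean 1 has no deviation. No such split is
    needed at \<open>q = 0\<close>, as an eigenvalue always has an eigenvector.\<close>
  proof (cases "q = 1")
    case True
    have "(\<integral>l. \<bar>resp C s p a l - q\<bar> \<partial>mu C s P) = (\<integral>l. 1 - resp C s p a l \<partial>mu C s P)"
      by (rule Bochner_Integration.integral_cong) (use True bd in auto)
    also have "\<dots> = 1 - q" using int by (simp add: prob_space q_def)
    finally show ?thesis using True by simp
  next
    case False
    \<comment> \<open>Otherwise \<open>E\<close> is the identity and \<open>q\<close> is the trace
      of the state, which is 1.\<close>
    have "\<exists>u\<in>carrier_vec n. E *\<^sub>v u \<noteq> u"
    proof (rule ccontr)
      assume "\<not> (\<exists>u\<in>carrier_vec n. E *\<^sub>v u \<noteq> u)"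
      then have "E * 1\<^sub>m n = 1\<^sub>m n" by (intro absorb_if_fixed[OF Ec(1) one_carrier_mat]) auto
      then have "E = 1\<^sub>m n" using Ec by simp
      then have "complex_of_real q = 1" using q rho by simp
      then show False using False by simp
    qed
    then obtain u where u: "u \<in> carrier_vec n" "E *\<^sub>v u \<noteq> u" by blast
    obtain w where w: "w \<in> carrier_vec n" "cinner w w = 1" "E *\<^sub>v w = 0\<^sub>v n"
    proof -
      obtain z where "cinner (z \<cdot>\<^sub>v (u - E *\<^sub>v u)) (z \<cdot>\<^sub>v (u - E *\<^sub>v u)) = 1" "E *\<^sub>v (z \<cdot>\<^sub>v (u - E *\<^sub>v u)) = 0\<^sub>v n"
        using projection_kernel_unit[OF Ec u] by blast
      then show thesis using that[of "z \<cdot>\<^sub>v (u - E *\<^sub>v u)"] u Ec by auto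
    qed
    obtain x where x: "x \<in> carrier_vec n" "x \<noteq> 0\<^sub>v n" "obs C s p *\<^sub>v x = complex_of_real a \<cdot>\<^sub>v x"
      using a by (auto simp: eigvals_def n_def)
    then have Ex: "E *\<^sub>v x = x" using eigproj_fixed[OF A x(1)] by (simp add: E_def n_def)
    obtain z where z: "cinner (z \<cdot>\<^sub>v x) (z \<cdot>\<^sub>v x) = 1" using normalize[OF x(1,2)] by blast
    have Ev: "E *\<^sub>v (z \<cdot>\<^sub>v x) = z \<cdot>\<^sub>v x" using mult_mat_vec[OF Ec(1) x(1)] Ex by simp
    have bound: "(\<integral>l. \<bar>resp C s p a l - q\<bar> \<partial>mu C s P) \<le> 4 * inverse (real (Suc L))" for L
      using deviation_le_inverse[OF anc ui pind P p a q[unfolded E_def] q01 _ z Ev[unfolded E_def] _ w(2) w(3)[unfolded E_def n_def], of "Suc L"]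
        x(1) w(1) by (simp add: n_def divide_inverse)
    have "(\<lambda>L. 4 * inverse (real (Suc L))) \<longlonglongrightarrow> 4 * 0"
      by (intro tendsto_mult tendsto_const LIMSEQ_inverse_real_of_nat)
    then have "(\<integral>l. \<bar>resp C s p a l - q\<bar> \<partial>mu C s P) \<le> 4 * 0"
      by (rule LIMSEQ_le_const) (use bound in auto)
    then show ?thesis by (intro antisym) auto
  qed
  then show "(\<integral>l. norm (complex_of_real (resp C s p a l) - tr (rho C s P * eigproj (sdim C s) (obs C s p) a)) \<partial>mu C s P) = 0"
    using q by (simp add: E_def flip: of_real_diff)
qed

end

theorem theorem3:
  fixes C :: "('s,'p,'m,'t,'l) com"
  assumes "complete_ontic_model C"
    and "ancilla_independence C"
    and "unitary_invariance C"
    and "parameter_independence C"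
  shows "\<forall>s. psi_complete C s"
proof -
  interpret complete_model C using assms(1) by unfold_locales
  show ?thesis using psi_complete assms(2-4) by blast
qed

end
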